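(* For all $L\in\{2,3,\ldots\}$ and $a>200L$ there exist $q\in(0,1)$ and an isometry-invariant kernel $J$ on $\mathbb{H}^1_L$ satisfying $J\sim aL\,n^{-2}\log\log(n)$ such that $\mathbb{P}_{q,J}(|K_0|=\infty)>0$.
   Context: $\mathbb{H}^1_L$ is the group $\bigoplus_{i=1}^\infty\mathbb{Z}/L\mathbb{Z}$ with ultrametric $\|x-y\|=L^{\max\{i:x_i\neq y_i\}}$ for $x\neq y$; edges are unordered pairs $e=\{x,y\}$ of distinct vertices with $|e|=\|x-y\|$. A kernel $J:E\to[0,\infty)$ is isometry-invariant if $J(e)=J(f)$ whenever $|e|=|f|$. $J\sim f$ means $\lim_{|e|\to\infty}J(e)/f(|e|)=1$. For $q\in[0,1]$, $\mathbb{P}_{q,J}$ is the law of the random graph in which each vertex is open independently with probability $q$ and, independently, each edge between open vertices is open independently with probability $1-\exp(-J(e))$; $K_0$ is the open cluster of the origin. *)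

theory Defs
  imports "HOL-Probability.Probability"
begin

text \<open>Vertices of the hierarchical lattice H^1_L: finitely supported sequences
  x_1, x_2, ... with entries in {0..L-1}. We use functions nat => nat with the
  unused coordinate 0 fixed to 0.\<close>
definition hvert :: "nat \<Rightarrow> (nat \<Rightarrow> nat) set" where
  "hvert L = {x. x 0 = 0 \<and> (\<forall>i. x i < L) \<and> finite {i. x i \<noteq> 0}}"

definition horigin :: "nat \<Rightarrow> nat" where
  "horigin = (\<lambda>_. 0)"

definition hdist :: "nat \<Rightarrow> (nat \<Rightarrow> nat) \<Rightarrow> (nat \<Rightarrow> nat) \<Rightarrow> real" where
  "hdist L x y = (if x = y then 0 else real L ^ Max {i. x i \<noteq> y i})"

definition hedges :: "nat \<Rightarrow> (nat \<Rightarrow> nat) set set" where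
  "hedges L = {{x, y} | x y. x \<in> hvert L \<and> y \<in> hvert L \<and> x \<noteq> y}"

definition elen :: "nat \<Rightarrow> (nat \<Rightarrow> nat) set \<Rightarrow> real" where
  "elen L e = Max {hdist L x y | x y. x \<in> e \<and> y \<in> e}"

definition isometry_invariant :: "nat \<Rightarrow> ((nat \<Rightarrow> nat) set \<Rightarrow> real) \<Rightarrow> bool" where
  "isometry_invariant L J \<longleftrightarrow>
     (\<forall>e\<in>hedges L. \<forall>f\<in>hedges L. elen L e = elen L f \<longrightarrow> J e = J f)"

definition kernel_asymp :: "nat \<Rightarrow> ((nat \<Rightarrow> nat) set \<Rightarrow> real) \<Rightarrow> (real \<Rightarrow> real) \<Rightarrow> bool" where
  "kernel_asymp L J g \<longleftrightarrow>
     (\<forall>\<epsilon>>0. \<exists>R. \<forall>e\<in>hedges L. elen L e \<ge> R \<longrightarrow> \<bar>J e / g (elen L e) - 1\<bar> < \<epsilon>)"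

definition perc_law :: "nat \<Rightarrow> real \<Rightarrow> ((nat \<Rightarrow> nat) set \<Rightarrow> real)
    \<Rightarrow> (((nat \<Rightarrow> nat) \<Rightarrow> bool) \<times> ((nat \<Rightarrow> nat) set \<Rightarrow> bool)) measure" where
  "perc_law L q J =
     (PiM (hvert L) (\<lambda>_. measure_pmf (bernoulli_pmf q)))
     \<Otimes>\<^sub>M (PiM (hedges L) (\<lambda>e. measure_pmf (bernoulli_pmf (1 - exp (- J e)))))"

definition open_edge :: "nat \<Rightarrow> ((nat \<Rightarrow> nat) \<Rightarrow> bool) \<Rightarrow> ((nat \<Rightarrow> nat) set \<Rightarrow> bool)
    \<Rightarrow> (nat \<Rightarrow> nat) set \<Rightarrow> bool" where
  "open_edge L \<omega> \<eta> e \<longleftrightarrow> e \<in> hedges L \<and> \<eta> e \<and> (\<forall>x\<in>e. \<omega> x)"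

definition cluster0 :: "nat \<Rightarrow> ((nat \<Rightarrow> nat) \<Rightarrow> bool) \<Rightarrow> ((nat \<Rightarrow> nat) set \<Rightarrow> bool)
    \<Rightarrow> (nat \<Rightarrow> nat) set" where
  "cluster0 L \<omega> \<eta> =
     {y. \<omega> horigin \<and> (horigin, y) \<in> {(u, v). open_edge L \<omega> \<eta> {u, v}}\<^sup>*}"

end

theory Submission
  imports Defs
begin

text \<open>
  Renormalisation controlled by second moments. In a block of size L^(k+1) join the
  distinguished clusters of its L subblocks whenever their density is at least 1/10. Two such
  clusters fail to be joined with probability at most exp(-J L^(2k) / 100), which for
  J = a L n^(-2) ln (ln n) at n = L^(k+1) is ((k+1) ln L)^(-a / (100 L)), hence summable in k because
  a > 200 L; on the finitely many small scales J may be taken as large as needed. Outside these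
  failures the density of the new cluster is the average of L independent truncated densities, so
  its variance v satisfies v' <= (81/128) v + failure probability, and is summable. By Chebyshev
  the mean density and the probability that the origin belongs to the distinguished cluster of its
  block lose only a summable small amount per scale, so both stay close to 1 on all scales.
\<close>

section \<open>Finite product measures\<close>

text \<open>The obstacle is dependence: whether two subcores get joined depends on the very clusters
  involved. Locality resolves it. A core is determined by the vertices and edges inside its block,
  so the subcores of distinct subblocks are independent, and once they are known the edges between
  them are still fresh. Declaring the core empty after a failed link costs at most 1 in the mean and
  1 in the second moment, so a failure enters only through its probability. The truncation estimate
  needs mean density at least 9/10, while the loss of mean per scale is controlled by the variance.
  Hence both are carried through one induction, for all blocks of a finite box at once, so that no
  translation invariance is invoked. With delta = 1/100 bounding both the closed vertices and the
  total of the failure probabilities, the mean loses less than 3 delta over all scales. All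
  estimates live on finite product laws, where every real function is integrable. They reach the
  infinite lattice only through events of finite boxes, followed by continuity from above along the
  events |K_0| >= n.\<close>

lemma finite_set_Pi_pmf_bool:
  fixes p :: "'a \<Rightarrow> bool pmf"
  assumes "finite I"
  shows "finite (set_pmf (Pi_pmf I d p))"
  by (rule finite_subset[OF set_Pi_pmf_subset'[OF assms] finite_PiE_dflt]) (use assms in auto)

text \<open>Stands in for measurability with respect to the coordinates in S: under a product law,
  functions depending on disjoint coordinate sets are independent.\<close>

definition depends_only_on :: "'i set \<Rightarrow> (('i \<Rightarrow> 'b) \<Rightarrow> 'c) \<Rightarrow> bool" where
  "depends_only_on S f \<longleftrightarrow> (\<forall>c c'. (\<forall>i\<in>S. c i = c' i) \<longrightarrow> f c = f c')"

lemma depends_only_onD: "depends_only_on S f \<Longrightarrow> (\<And>i. i \<in> S \<Longrightarrow> c i = c' i) \<Longrightarrow> f c = f c'"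
  by (auto simp: depends_only_on_def)

lemma depends_only_on_mono: "depends_only_on S f \<Longrightarrow> S \<subseteq> T \<Longrightarrow> depends_only_on T f"
  by (auto simp: depends_only_on_def subset_iff)

lemma depends_only_on_comp: "depends_only_on S f \<Longrightarrow> depends_only_on S (\<lambda>c. g (f c))"
  unfolding depends_only_on_def by metis

lemma depends_only_on_comp2:
  "depends_only_on S f \<Longrightarrow> depends_only_on S h \<Longrightarrow> depends_only_on S (\<lambda>c. g (f c) (h c))"
  unfolding depends_only_on_def by metis

lemma expectation_pair_pmf_mult:
  fixes f :: "'a \<Rightarrow> real" and g :: "'b \<Rightarrow> real"
  assumes "finite (set_pmf P)" "finite (set_pmf Q)"
  shows "measure_pmf.expectation (pair_pmf P Q) (\<lambda>z. f (fst z) * g (snd z)) =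
         measure_pmf.expectation P f * measure_pmf.expectation Q g"
proof -
  have "measure_pmf.expectation (pair_pmf P Q) (\<lambda>z. f (fst z) * g (snd z)) =
     (\<Sum>z\<in>set_pmf P \<times> set_pmf Q. f (fst z) * g (snd z) * pmf (pair_pmf P Q) z)"
    by (rule integral_measure_pmf_real) (use assms in auto)
  also have "\<dots> = (\<Sum>x\<in>set_pmf P. \<Sum>y\<in>set_pmf Q. (f x * pmf P x) * (g y * pmf Q y))"
    by (subst sum.cartesian_product) (auto simp: pmf_pair intro!: sum.cong)
  also have "\<dots> = (\<Sum>x\<in>set_pmf P. f x * pmf P x) * (\<Sum>y\<in>set_pmf Q. g y * pmf Q y)"
    by (rule sum_product[symmetric])
  also have "(\<Sum>x\<in>set_pmf P. f x * pmf P x) = measure_pmf.expectation P f"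
    by (rule integral_measure_pmf_real[symmetric]) (use assms in auto)
  also have "(\<Sum>x\<in>set_pmf Q. g x * pmf Q x) = measure_pmf.expectation Q g"
    by (rule integral_measure_pmf_real[symmetric]) (use assms in auto)
  finally show ?thesis .
qed

lemma expectation_pmf_cong:
  fixes f g :: "'a \<Rightarrow> real"
  assumes "\<And>x. x \<in> set_pmf P \<Longrightarrow> f x = g x"
  shows "measure_pmf.expectation P f = measure_pmf.expectation P g"
  using assms by (intro integral_cong_AE) (auto simp: AE_measure_pmf_iff)

text \<open>The product law on I is the image of the pair of product laws on the part of I inside S
  and the part outside; f reads only the first factor and g only the second.\<close>

lemma expectation_Pi_pmf_mult:
  fixes f g :: "('i \<Rightarrow> bool) \<Rightarrow> real"
  assumes I: "finite I" and f: "depends_only_on S f" and g: "depends_only_on T g"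
    and disj: "S \<inter> T = {}"
  shows "measure_pmf.expectation (Pi_pmf I d p) (\<lambda>c. f c * g c) =
         measure_pmf.expectation (Pi_pmf I d p) f * measure_pmf.expectation (Pi_pmf I d p) g"
proof -
  let ?A = "I \<inter> S" and ?B = "I - S"
  let ?P = "Pi_pmf ?A d p" and ?Q = "Pi_pmf ?B d p"
  define m where "m = (\<lambda>z :: ('i \<Rightarrow> bool) \<times> ('i \<Rightarrow> bool). \<lambda>x. if x \<in> ?A then fst z x else snd z x)"
  have split: "Pi_pmf I d p = map_pmf m (pair_pmf ?P ?Q)"
    using Pi_pmf_union[of ?A ?B d p] I
    by (simp add: Int_Diff_Un Int_Diff_disjoint m_def case_prod_beta')
  have fin: "finite (set_pmf ?P)" "finite (set_pmf ?Q)"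
    using I by (auto intro!: finite_set_Pi_pmf_bool)
  \<comment> \<open>S may reach outside I. There both factors take the default \<open>d\<close>, so
    f cannot distinguish \<open>m z\<close> from \<open>fst z\<close>.\<close>
  have fm: "f (m z) = f (fst z)" and gm: "g (m z) = g (snd z)" if "z \<in> set_pmf (pair_pmf ?P ?Q)" for z
  proof -
    have "fst z \<in> set_pmf ?P" "snd z \<in> set_pmf ?Q" using that by auto
    hence *: "\<And>x. x \<notin> ?A \<Longrightarrow> fst z x = d" "\<And>x. x \<notin> ?B \<Longrightarrow> snd z x = d"
      using set_Pi_pmf_subset[of ?A d p] set_Pi_pmf_subset[of ?B d p] I by blast+
    show "f (m z) = f (fst z)"
      by (rule depends_only_onD[OF f]) (use * in \<open>auto simp: m_def\<close>)
    show "g (m z) = g (snd z)"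
      by (rule depends_only_onD[OF g]) (use * disj in \<open>auto simp: m_def\<close>)
  qed
  let ?E = "measure_pmf.expectation (pair_pmf ?P ?Q)"
  have "measure_pmf.expectation (Pi_pmf I d p) (\<lambda>c. f c * g c) = ?E (\<lambda>z. f (m z) * g (m z))"
    by (subst split) (simp only: integral_map_pmf)
  also have "\<dots> = ?E (\<lambda>z. f (fst z) * g (snd z))"
    by (rule expectation_pmf_cong) (simp only: fm gm)
  also have "\<dots> = measure_pmf.expectation ?P f * measure_pmf.expectation ?Q g"
    by (rule expectation_pair_pmf_mult[OF fin])
  also have "measure_pmf.expectation ?P f = ?E (\<lambda>z. f (fst z))"
    by simp
  also have "\<dots> = ?E (\<lambda>z. f (m z))"
    by (rule expectation_pmf_cong) (simp only: fm gm)
  also have "\<dots> = measure_pmf.expectation (Pi_pmf I d p) f"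
    by (subst split) (simp only: integral_map_pmf)
  also have "measure_pmf.expectation ?Q g = ?E (\<lambda>z. g (snd z))"
    by simp
  also have "\<dots> = ?E (\<lambda>z. g (m z))"
    by (rule expectation_pmf_cong) (simp only: fm gm)
  also have "\<dots> = measure_pmf.expectation (Pi_pmf I d p) g"
    by (subst split) (simp only: integral_map_pmf)
  finally show ?thesis .
qed

text \<open>Conditioning on h without conditional probabilities: for each fixed value k the events
  \<open>h c = k\<close> and \<open>G k c\<close> are independent, and the weights of the values sum
  to 1. Later h is a pair of subcores and G the absence of an edge between them.\<close>

lemma prob_Pi_pmf_conditional_le:
  fixes G :: "'k \<Rightarrow> ('i \<Rightarrow> bool) \<Rightarrow> bool"
  assumes I: "finite I" and K: "finite K" "\<And>c. h c \<in> K" and h: "depends_only_on S h"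
    and G: "\<And>k. k \<in> K \<Longrightarrow> depends_only_on (T k) (G k)" "\<And>k. k \<in> K \<Longrightarrow> S \<inter> T k = {}"
    and b: "\<And>k. k \<in> K \<Longrightarrow> measure_pmf.prob (Pi_pmf I d p) {c. G k c} \<le> b"
  shows "measure_pmf.prob (Pi_pmf I d p) {c. G (h c) c} \<le> b"
proof -
  let ?P = "Pi_pmf I d p" let ?E = "measure_pmf.expectation ?P"
  note int = integrable_measure_pmf_finite[OF finite_set_Pi_pmf_bool[OF I]]
  have 1: "indicator {c. G (h c) c} c = (\<Sum>k\<in>K. of_bool (h c = k) * of_bool (G k c) :: real)" for c
  proof -
    have "(\<Sum>k\<in>K. of_bool (h c = k) * of_bool (G k c) :: real) = (\<Sum>k\<in>K. if k = h c then of_bool (G k c) else 0)"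
      by (intro sum.cong) auto
    thus ?thesis using K by (auto simp: indicator_def)
  qed
  have "measure_pmf.prob ?P {c. G (h c) c} = ?E (indicator {c. G (h c) c})"
    by simp
  also have "\<dots> = (\<Sum>k\<in>K. ?E (\<lambda>c. of_bool (h c = k) * of_bool (G k c)))"
    unfolding 1 by (intro Bochner_Integration.integral_sum int)
  also have "\<dots> = (\<Sum>k\<in>K. ?E (\<lambda>c. of_bool (h c = k)) * ?E (\<lambda>c. of_bool (G k c)))"
  proof (intro sum.cong refl)
    fix k assume k: "k \<in> K"
    show "?E (\<lambda>c. of_bool (h c = k) * of_bool (G k c) :: real) = ?E (\<lambda>c. of_bool (h c = k)) * ?E (\<lambda>c. of_bool (G k c))"
      by (rule expectation_Pi_pmf_mult[OF I depends_only_on_comp[OF h]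
            depends_only_on_comp[OF G(1)[OF k]] G(2)[OF k]])
  qed
  also have "\<dots> \<le> (\<Sum>k\<in>K. ?E (\<lambda>c. of_bool (h c = k)) * b)"
  proof (intro sum_mono mult_left_mono)
    fix k assume k: "k \<in> K"
    have "(\<lambda>c. of_bool (G k c) :: real) = indicator {c. G k c}"
      by (auto simp: indicator_def)
    thus "?E (\<lambda>c. of_bool (G k c)) \<le> b" using b[OF k] by simp
  qed (auto intro!: Bochner_Integration.integral_nonneg)
  also have "\<dots> = ?E (\<lambda>c. \<Sum>k\<in>K. of_bool (h c = k)) * b"
    by (subst Bochner_Integration.integral_sum[OF int]) (simp add: sum_distrib_right)
  also have "(\<lambda>c. \<Sum>k\<in>K. of_bool (h c = k) :: real) = (\<lambda>_. 1)"
  proof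
    fix c
    have "(\<Sum>k\<in>K. of_bool (h c = k) :: real) = (\<Sum>k\<in>K. if k = h c then 1 else 0)"
      by (intro sum.cong) auto
    thus "(\<Sum>k\<in>K. of_bool (h c = k) :: real) = 1" using K by simp
  qed
  finally show ?thesis by simp
qed

text \<open>Discarding a subblock of density below 1/10 costs at most 1/10 in density, and has
  probability at most of the order of the variance by Chebyshev. The last bound is why the step of
  the renormalisation contracts: 81/64 is less than the number L of independent subblocks.\<close>

lemma expectation_truncation:
  fixes X :: "'a \<Rightarrow> real"
  assumes fin: "finite (set_pmf P)" and mean: "measure_pmf.expectation P X \<ge> 9/10"
  defines "X' \<equiv> (\<lambda>c. if X c \<ge> 1/10 then X c else 0)"
  shows "measure_pmf.prob P {c. X c < 1/10} \<le> 25/16 * measure_pmf.variance P X"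
    and "measure_pmf.expectation P X' \<ge> measure_pmf.expectation P X - 5/32 * measure_pmf.variance P X"
    and "measure_pmf.variance P X' \<le> 81/64 * measure_pmf.variance P X"
proof -
  let ?E = "measure_pmf.expectation P" let ?\<mu> = "?E X"
  note int[simp] = integrable_measure_pmf_finite[OF fin]
  have sq: "1 \<le> 25/16 * (X c - ?\<mu>)^2" if "X c < 1/10" for c
  proof -
    \<comment> \<open>8/10 is the gap between the mean bound 9/10 and the threshold 1/10; 25/16 is
      the inverse of its square.\<close>
    have "(8/10)^2 \<le> (?\<mu> - X c)^2" by (rule power_mono) (use that mean in auto)
    thus ?thesis by (simp add: power2_commute[of "X c"] power_divide field_simps)
  qed
  have "measure_pmf.prob P {c. X c < 1/10} = ?E (indicator {c. X c < 1/10})"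
    by simp
  also have "\<dots> \<le> ?E (\<lambda>c. 25/16 * (X c - ?\<mu>)^2)"
    by (rule integral_mono) (use sq in \<open>auto simp: indicator_def\<close>)
  finally show "measure_pmf.prob P {c. X c < 1/10} \<le> 25/16 * measure_pmf.variance P X" by simp
  \<comment> \<open>Where X is truncated the loss is below 1/10, and 5/32 = 1/10 * 25/16.\<close>
  have "?E (\<lambda>c. X c - 5/32 * (X c - ?\<mu>)^2) \<le> ?E X'"
  proof (rule integral_mono)
    fix c show "X c - 5/32 * (X c - ?\<mu>)^2 \<le> X' c"
      using sq[of c] by (cases "X c < 1/10") (auto simp: X'_def)
  qed auto
  thus "?E X' \<ge> ?\<mu> - 5/32 * measure_pmf.variance P X" by simp
  have "measure_pmf.variance P X' \<le> ?E (\<lambda>c. (X' c - ?\<mu>)^2)"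
  proof -
    have "?E (\<lambda>c. (X' c - ?\<mu>)^2) = ?E (\<lambda>c. (X' c - ?E X')^2 + 2 * (?E X' - ?\<mu>) * (X' c - ?E X') + (?E X' - ?\<mu>)^2)"
      by (intro Bochner_Integration.integral_cong refl) (simp add: power2_eq_square algebra_simps)
    also have "\<dots> = measure_pmf.variance P X' + (?E X' - ?\<mu>)^2" by simp
    finally show ?thesis by simp
  qed
  also have "\<dots> \<le> ?E (\<lambda>c. 81/64 * (X c - ?\<mu>)^2)"
  proof (rule integral_mono)
    fix c
    show "(X' c - ?\<mu>)^2 \<le> 81/64 * (X c - ?\<mu>)^2"
    proof (cases "X c < 1/10")
      case True
      \<comment> \<open>Here X' deviates from the mean by the full mean, while X deviates by at
        least 8/9 of it, because 1/10 is at most a ninth of the mean. Hence 81/64 = (9/8)^2.\<close>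
      have "(8/9 * ?\<mu>)^2 \<le> (?\<mu> - X c)^2" by (rule power_mono) (use True mean in auto)
      thus ?thesis using True by (simp add: X'_def power2_eq_square algebra_simps)
    qed (auto simp: X'_def)
  qed auto
  finally show "measure_pmf.variance P X' \<le> 81/64 * measure_pmf.variance P X" by simp
qed

lemma variance_le_about:
  fixes X :: "'a \<Rightarrow> real"
  assumes fin: "finite (set_pmf P)"
  shows "measure_pmf.variance P X \<le> measure_pmf.expectation P (\<lambda>c. (X c - s)^2)"
proof -
  let ?E = "measure_pmf.expectation P"
  note int[simp] = integrable_measure_pmf_finite[OF fin]
  have "?E (\<lambda>c. (X c - s)^2) = ?E (\<lambda>c. (X c - ?E X)^2 + 2 * (?E X - s) * (X c - ?E X) + (?E X - s)^2)"
    by (intro Bochner_Integration.integral_cong refl) (simp add: power2_eq_square algebra_simps)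
  also have "\<dots> = measure_pmf.variance P X + (?E X - s)^2" by simp
  finally show ?thesis by simp
qed

lemma second_moment_sum_orthogonal:
  fixes Z :: "'d \<Rightarrow> 'a \<Rightarrow> real"
  assumes fin: "finite (set_pmf P)"
    and orth: "\<And>i j. i \<in> D \<Longrightarrow> j \<in> D \<Longrightarrow> i \<noteq> j \<Longrightarrow> measure_pmf.expectation P (\<lambda>c. Z i c * Z j c) = 0"
    and D: "finite D"
  shows "measure_pmf.expectation P (\<lambda>c. (\<Sum>d\<in>D. Z d c)^2) = (\<Sum>d\<in>D. measure_pmf.expectation P (\<lambda>c. (Z d c)^2))"
proof -
  let ?E = "measure_pmf.expectation P"
  note int[simp] = integrable_measure_pmf_finite[OF fin]
  have "?E (\<lambda>c. (\<Sum>d\<in>D. Z d c)^2) = ?E (\<lambda>c. \<Sum>i\<in>D. \<Sum>j\<in>D. Z i c * Z j c)"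
    by (simp add: power2_eq_square sum_product)
  also have "\<dots> = (\<Sum>i\<in>D. \<Sum>j\<in>D. ?E (\<lambda>c. Z i c * Z j c))"
    by (subst Bochner_Integration.integral_sum, simp)+ (rule refl)
  also have "\<dots> = (\<Sum>i\<in>D. \<Sum>j\<in>D. if j = i then ?E (\<lambda>c. Z i c * Z i c) else 0)"
    by (intro sum.cong refl) (use orth in auto)
  also have "\<dots> = (\<Sum>d\<in>D. ?E (\<lambda>c. (Z d c)^2))"
    using D by (simp add: power2_eq_square)
  finally show ?thesis .
qed

section \<open>Blocks and their cores\<close>

text \<open>For y in \<open>hvert L\<close> this is the closed ultrametric ball of radius L^k around
  y. Recursion on the highest free digit exhibits its L children.\<close>

primrec block :: "nat \<Rightarrow> nat \<Rightarrow> (nat \<Rightarrow> nat) \<Rightarrow> (nat \<Rightarrow> nat) set" where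
  "block L 0 y = {y}"
| "block L (Suc k) y = (\<Union>d<L. block L k (y(Suc k := d)))"

text \<open>A percolation configuration is encoded as one predicate on vertex sets: a singleton
  stands for its vertex, a doubleton for the edge between its two points.\<close>

definition linked :: "('a set \<Rightarrow> bool) \<Rightarrow> 'a set \<Rightarrow> 'a set \<Rightarrow> bool" where
  "linked c A B \<longleftrightarrow> (\<exists>u\<in>A. \<exists>v\<in>B. c {u, v})"

text \<open>Index set of the configuration inside B: the case u = v contributes the vertices, the
  other cases the edges.\<close>

definition pairs :: "'a set \<Rightarrow> 'a set set" where
  "pairs B = {{u, v} | u v. u \<in> B \<and> v \<in> B}"

text \<open>The core of a block discards the subblocks whose core has density below 1/10, and is empty as
  soon as two of the remaining subcores are not joined by an open edge; so it is always connected
  and its density is, outside the rare failure event, the average of truncated densities of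
  independent subblocks. The coordinates 1, ..., k of the label y are irrelevant.\<close>

primrec core :: "nat \<Rightarrow> nat \<Rightarrow> (nat \<Rightarrow> nat) \<Rightarrow> ((nat \<Rightarrow> nat) set \<Rightarrow> bool) \<Rightarrow> (nat \<Rightarrow> nat) set" where
  "core L 0 y c = (if c {y} then {y} else {})"
| "core L (Suc k) y c =
    (let K = \<lambda>d. core L k (y(Suc k := d)) c; G = {d. d < L \<and> L ^ k \<le> 10 * card (K d)}
     in if \<forall>d\<in>G. \<forall>d'\<in>G. d \<noteq> d' \<longrightarrow> linked c (K d) (K d') then \<Union>d\<in>G. K d else {})"

definition core_fails :: "nat \<Rightarrow> nat \<Rightarrow> (nat \<Rightarrow> nat) \<Rightarrow> ((nat \<Rightarrow> nat) set \<Rightarrow> bool) \<Rightarrow> bool" where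
  "core_fails L k y c \<longleftrightarrow>
    (\<exists>d<L. \<exists>d'<L. d \<noteq> d' \<and> L ^ k \<le> 10 * card (core L k (y(Suc k := d)) c) \<and>
       L ^ k \<le> 10 * card (core L k (y(Suc k := d')) c) \<and>
       \<not> linked c (core L k (y(Suc k := d)) c) (core L k (y(Suc k := d')) c))"

definition dens :: "nat \<Rightarrow> nat \<Rightarrow> (nat \<Rightarrow> nat) \<Rightarrow> ((nat \<Rightarrow> nat) set \<Rightarrow> bool) \<Rightarrow> real" where
  "dens L k y c = card (core L k y c) / L ^ k"

lemma core_Suc:
  "core L (Suc k) y c = (if core_fails L k y c then {}
     else \<Union>d\<in>{d. d < L \<and> L ^ k \<le> 10 * card (core L k (y(Suc k := d)) c)}. core L k (y(Suc k := d)) c)"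
  unfolding core.simps Let_def core_fails_def by auto

declare core.simps(2) [simp del]

lemma block_agree: "x \<in> block L k y \<Longrightarrow> k < i \<Longrightarrow> x i = y i"
proof (induction k arbitrary: y)
  case (Suc k)
  then obtain d where "x \<in> block L k (y(Suc k := d))" by auto
  from Suc.IH[OF this] Suc.prems(2) show ?case by simp
qed simp

lemma block_child_digit: "x \<in> block L k (y(Suc k := d)) \<Longrightarrow> x (Suc k) = d"
  using block_agree[of x L k "y(Suc k := d)" "Suc k"] by simp

lemma block_children_disjoint:
  "d \<noteq> d' \<Longrightarrow> block L k (y(Suc k := d)) \<inter> block L k (y(Suc k := d')) = {}"
  by (auto dest!: block_child_digit)

lemma finite_block [simp]: "finite (block L k y)"
  by (induction k arbitrary: y) auto

lemma card_block_le: "card (block L k y) \<le> L ^ k"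
proof (induction k arbitrary: y)
  case (Suc k)
  have "card (block L (Suc k) y) \<le> (\<Sum>d<L. card (block L k (y(Suc k := d))))"
    unfolding block.simps by (rule card_UN_le) simp
  also have "\<dots> \<le> (\<Sum>d<L. L ^ k)" by (intro sum_mono Suc.IH)
  finally show ?case by simp
qed simp

lemma block_subset_hvert: "y \<in> hvert L \<Longrightarrow> block L k y \<subseteq> hvert L"
proof (induction k arbitrary: y)
  case (Suc k)
  have "y(Suc k := d) \<in> hvert L" if "d < L" for d
  proof -
    have "{i. (y(Suc k := d)) i \<noteq> 0} \<subseteq> insert (Suc k) {i. y i \<noteq> 0}" by auto
    hence "finite {i. (y(Suc k := d)) i \<noteq> 0}"
      by (rule finite_subset) (use Suc.prems in \<open>simp add: hvert_def\<close>)
    with Suc.prems that show ?thesis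
      unfolding hvert_def by simp
  qed
  with Suc.IH show ?case unfolding block.simps by blast
qed simp

lemma horigin_in_hvert: "0 < L \<Longrightarrow> horigin \<in> hvert L"
  by (simp add: hvert_def horigin_def)

lemma horigin_upd [simp]: "horigin(i := 0) = horigin"
  by (auto simp: horigin_def)

lemma core_subset_block: "core L k y c \<subseteq> block L k y"
proof (induction k arbitrary: y)
  case (Suc k)
  have "x \<in> block L (Suc k) y" if "x \<in> core L (Suc k) y c" for x
  proof -
    from that obtain d where "d < L" "x \<in> core L k (y(Suc k := d)) c"
      unfolding core_Suc by (auto split: if_splits)
    thus ?thesis using Suc.IH unfolding block.simps by blast
  qed
  thus ?case by blast
qed auto

lemma finite_core [simp]: "finite (core L k y c)"
  using core_subset_block finite_block by (rule finite_subset)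

lemma card_core_le: "card (core L k y c) \<le> L ^ k"
  using card_mono[OF finite_block core_subset_block] card_block_le by (rule order_trans)

lemma pairs_mono: "A \<subseteq> B \<Longrightarrow> pairs A \<subseteq> pairs B"
  by (auto simp: pairs_def)

lemma pairs_iff: "e \<in> pairs B \<longleftrightarrow> e \<subseteq> B \<and> e \<noteq> {} \<and> card e \<le> 2 \<and> finite e"
proof
  assume "e \<in> pairs B"
  thus "e \<subseteq> B \<and> e \<noteq> {} \<and> card e \<le> 2 \<and> finite e"
    by (auto simp: pairs_def intro!: order_trans[OF card_insert_le_m1])
next
  assume e: "e \<subseteq> B \<and> e \<noteq> {} \<and> card e \<le> 2 \<and> finite e"
  hence "card e = 1 \<or> card e = 2" using card_gt_0_iff[of e] by linarith
  then obtain u v where "e = {u, v}"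
    by (metis card_1_singletonE card_2_iff insert_absorb2)
  thus "e \<in> pairs B" using e by (auto simp: pairs_def)
qed

lemma pairs_disjoint: "A \<inter> B = {} \<Longrightarrow> pairs A \<inter> pairs B = {}"
  by (simp add: disjoint_iff pairs_iff) blast

lemma finite_pairs: "finite B \<Longrightarrow> finite (pairs B)"
  by (rule finite_subset[of _ "Pow B"]) (auto simp: pairs_iff)

text \<open>The locality that makes cores of disjoint blocks independent and keeps the edges between
  two children independent of both subcores.\<close>

lemma depends_core: "depends_only_on (pairs (block L k y)) (core L k y)"
proof (induction k arbitrary: y)
  case 0
  show ?case by (auto simp: depends_only_on_def pairs_def)
next
  case (Suc k)
  show ?case unfolding depends_only_on_def
  proof (intro allI impI)
    fix c c' :: "(nat \<Rightarrow> nat) set \<Rightarrow> bool"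
    assume eq: "\<forall>e\<in>pairs (block L (Suc k) y). c e = c' e"
    have core: "core L k (y(Suc k := d)) c = core L k (y(Suc k := d)) c'" if "d < L" for d
    proof (rule depends_only_onD[OF Suc.IH])
      fix e assume "e \<in> pairs (block L k (y(Suc k := d)))"
      hence "e \<in> pairs (block L (Suc k) y)"
        using that by (auto simp: pairs_def)
      thus "c e = c' e" using eq by blast
    qed
    have link: "linked c (core L k (y(Suc k := d)) c') (core L k (y(Suc k := d')) c') =
        linked c' (core L k (y(Suc k := d)) c') (core L k (y(Suc k := d')) c')"
      if "d < L" "d' < L" for d d'
    proof -
      have "{u, v} \<in> pairs (block L (Suc k) y)"
        if "u \<in> core L k (y(Suc k := d)) c'" "v \<in> core L k (y(Suc k := d')) c'" for u v
        using that \<open>d < L\<close> \<open>d' < L\<close> core_subset_block[of L k "y(Suc k := d)" c']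
          core_subset_block[of L k "y(Suc k := d')" c']
        unfolding pairs_def block.simps by blast
      with eq show ?thesis unfolding linked_def by blast
    qed
    have "core_fails L k y c = core_fails L k y c'"
      unfolding core_fails_def using core link by (metis (no_types, lifting))
    thus "core L (Suc k) y c = core L (Suc k) y c'"
      unfolding core_Suc using core by (auto cong: conj_cong)
  qed
qed

section \<open>Connectedness of cores and lengths of edges between children\<close>

definition open_step :: "('a set \<Rightarrow> bool) \<Rightarrow> ('a \<times> 'a) set" where
  "open_step c = {(u, v). u \<noteq> v \<and> c {u, v} \<and> c {u} \<and> c {v}}"

lemma core_connected:
  "u \<in> core L k y c \<Longrightarrow> c {u} \<and> (\<forall>v\<in>core L k y c. (u, v) \<in> (open_step c)\<^sup>*)"
proof (induction k arbitrary: y u)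
  case (Suc k)
  let ?K = "\<lambda>d. core L k (y(Suc k := d)) c"
  from Suc.prems obtain d where nf: "\<not> core_fails L k y c" and
    d: "d < L" "L ^ k \<le> 10 * card (?K d)" "u \<in> ?K d"
    unfolding core_Suc by (auto split: if_splits)
  show ?case
  proof (intro conjI ballI)
    show "c {u}" using Suc.IH[OF d(3)] by blast
    fix v assume "v \<in> core L (Suc k) y c"
    then obtain d' where d': "d' < L" "L ^ k \<le> 10 * card (?K d')" "v \<in> ?K d'"
      unfolding core_Suc by (auto split: if_splits)
    show "(u, v) \<in> (open_step c)\<^sup>*"
    proof (cases "d = d'")
      case True
      thus ?thesis using Suc.IH[OF d(3)] d'(3) by blast
    next
      case False
      hence "linked c (?K d) (?K d')"
        using nf d(1,2) d'(1,2) unfolding core_fails_def by blast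
      then obtain a b where ab: "a \<in> ?K d" "b \<in> ?K d'" "c {a, b}"
        unfolding linked_def by blast
      \<comment> \<open>Excludes that \<open>{a, b}\<close> is a singleton, which would encode a
        vertex instead of an edge.\<close>
      have "a \<noteq> b"
        using block_children_disjoint[OF False, of L k y] ab core_subset_block by fastforce
      hence "(a, b) \<in> open_step c"
        using ab Suc.IH[OF ab(1)] Suc.IH[OF ab(2)] by (simp add: open_step_def)
      moreover have "(u, a) \<in> (open_step c)\<^sup>*" "(b, v) \<in> (open_step c)\<^sup>*"
        using Suc.IH[OF d(3)] Suc.IH[OF ab(2)] ab d'(3) by blast+
      ultimately show ?thesis by (meson rtrancl.rtrancl_into_rtrancl rtrancl_trans)
    qed
  qed
qed auto

text \<open>Above digit k + 1 both points agree with y, so that digit is the top difference. All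
  edges between children of a block thus share one kernel value per scale.\<close>

lemma hdist_children:
  assumes "u \<in> block L (Suc k) y" "v \<in> block L (Suc k) y" "u (Suc k) \<noteq> v (Suc k)"
  shows "hdist L u v = real L ^ Suc k"
proof -
  have "i \<le> Suc k" if "u i \<noteq> v i" for i
    using block_agree[OF assms(1), of i] block_agree[OF assms(2), of i] that by (metis not_le)
  hence "Max {i. u i \<noteq> v i} = Suc k"
    using assms(3) by (intro Max_eqI) (auto intro: finite_subset[of _ "{..Suc k}"])
  thus ?thesis using assms(3) by (auto simp: hdist_def)
qed

lemma hdist_commute: "hdist L x y = hdist L y x"
  unfolding hdist_def by (simp add: eq_commute)

lemma elen_doubleton: "elen L {u, v} = hdist L u v"
proof -
  have "{hdist L x y | x y. x \<in> {u, v} \<and> y \<in> {u, v}} = {0, hdist L u v}"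
    by (auto simp: hdist_commute) (auto simp: hdist_def)
  moreover have "0 \<le> hdist L u v" by (simp add: hdist_def)
  ultimately show ?thesis unfolding elen_def by simp
qed

section \<open>One renormalisation step\<close>

lemma prob_not_linked_le:
  assumes I: "finite I" and sub: "pairs (A \<union> B) \<subseteq> I" and fin: "finite A" "finite B" and disj: "A \<inter> B = {}"
    and p: "\<And>u v. u \<in> A \<Longrightarrow> v \<in> B \<Longrightarrow> pmf (p {u, v}) False \<le> exp (- j)"
  shows "measure_pmf.prob (Pi_pmf I False p) {c. \<not> linked c A B} \<le> exp (- j * (real (card A) * real (card B)))"
proof -
  define X where "X = (\<lambda>(u, v). {u, v}) ` (A \<times> B)"
  have XI: "X \<subseteq> I" using sub by (auto simp: X_def pairs_def)
  \<comment> \<open>Disjointness of A and B makes the joining edges pairwise distinct, so their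
    number is the product of the cardinalities.\<close>
  have inj: "inj_on (\<lambda>(u, v). {u, v}) (A \<times> B)"
    using disj by (auto simp: inj_on_def doubleton_eq_iff)
  have cardX: "card X = card A * card B"
    unfolding X_def by (simp add: card_image[OF inj] card_cartesian_product)
  let ?F = "\<lambda>e. if e \<in> X then {False} else UNIV"
  have "{c. \<not> linked c A B} = Pi I ?F"
    using XI by (auto simp: linked_def X_def Pi_def)
  hence "measure_pmf.prob (Pi_pmf I False p) {c. \<not> linked c A B} = (\<Prod>e\<in>I. measure_pmf.prob (p e) (?F e))"
    using measure_Pi_pmf_Pi[OF I] by simp
  also have "\<dots> = (\<Prod>e\<in>X. pmf (p e) False)"
    by (intro prod.mono_neutral_cong_right I XI) (auto simp: measure_pmf_single)
  also have "\<dots> \<le> (\<Prod>e\<in>X. exp (- j))"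
    by (intro prod_mono) (use p in \<open>auto simp: X_def\<close>)
  also have "\<dots> = exp (- j * (real (card A) * real (card B)))"
    by (simp add: cardX exp_of_nat_mult[symmetric] mult.commute)
  finally show ?thesis .
qed

text \<open>Given two subcores of density at least 1/10, at least (L^k / 10)^2 fresh edges would all
  have to be closed. The factor L^2 is a union bound over ordered pairs of children.\<close>

lemma prob_core_fails_le:
  assumes I: "finite I" and sub: "pairs (block L (Suc k) y) \<subseteq> I"
    and j: "0 \<le> j"
    and p: "\<And>u v. u \<in> block L (Suc k) y \<Longrightarrow> v \<in> block L (Suc k) y \<Longrightarrow> u (Suc k) \<noteq> v (Suc k) \<Longrightarrow>
              pmf (p {u, v}) False \<le> exp (- j)"
  shows "measure_pmf.prob (Pi_pmf I False p) {c. core_fails L k y c}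
           \<le> (real L)^2 * exp (- j * (real L ^ k / 10)^2)"
proof -
  let ?P = "Pi_pmf I False p"
  let ?b = "exp (- j * (real L ^ k / 10)^2)"
  let ?B = "\<lambda>d. block L k (y(Suc k := d))" and ?K = "\<lambda>d. core L k (y(Suc k := d))"
  let ?Q = "\<lambda>d d' c. d \<noteq> d' \<and> L ^ k \<le> 10 * card (?K d c) \<and> L ^ k \<le> 10 * card (?K d' c) \<and> \<not> linked c (?K d c) (?K d' c)"
  have pair: "measure_pmf.prob ?P {c. ?Q d d' c} \<le> ?b" if d: "d < L" "d' < L" for d d'
  proof (cases "d = d'")
    case True
    thus ?thesis by simp
  next
    case False
    have disj: "?B d \<inter> ?B d' = {}" by (rule block_children_disjoint[OF False])
    have Bsub: "?B d \<union> ?B d' \<subseteq> block L (Suc k) y" using d by auto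
    define h where "h = (\<lambda>c. (?K d c, ?K d' c))"
    define G where "G = (\<lambda>(A :: (nat \<Rightarrow> nat) set, B) c. L ^ k \<le> 10 * card A \<and> L ^ k \<le> 10 * card B \<and> \<not> linked c A B)"
    \<comment> \<open>Only edges from A to B are listed; having an endpoint in each child, they
      avoid the coordinates that determine the subcores.\<close>
    define T where "T = (\<lambda>(A :: (nat \<Rightarrow> nat) set, B). {{u, v} | u v. u \<in> A \<and> v \<in> B})"
    have "measure_pmf.prob ?P {c. G (h c) c} \<le> ?b"
    proof (rule prob_Pi_pmf_conditional_le[where h = h and G = G and T = T
          and K = "Pow (?B d) \<times> Pow (?B d')" and S = "pairs (?B d) \<union> pairs (?B d')", OF I])
      show "finite (Pow (?B d) \<times> Pow (?B d'))" by simp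
      show "h c \<in> Pow (?B d) \<times> Pow (?B d')" for c
        using core_subset_block by (simp add: h_def)
      show "depends_only_on (pairs (?B d) \<union> pairs (?B d')) h"
        unfolding h_def
        by (rule depends_only_on_comp2[where g = Pair]; rule depends_only_on_mono[OF depends_core]) auto
    next
      fix AB assume "AB \<in> Pow (?B d) \<times> Pow (?B d')"
      then obtain A B where AB: "AB = (A, B)" "A \<subseteq> ?B d" "B \<subseteq> ?B d'" by auto
      have dAB: "A \<inter> B = {}" using disj AB by blast
      show "depends_only_on (T AB) (G AB)"
        unfolding depends_only_on_def AB G_def T_def linked_def prod.case by blast
      show "(pairs (?B d) \<union> pairs (?B d')) \<inter> T AB = {}"
      proof (intro equals0I)
        fix e assume "e \<in> (pairs (?B d) \<union> pairs (?B d')) \<inter> T AB"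
        then obtain u v where "u \<in> A" "v \<in> B" "e = {u, v}" "e \<subseteq> ?B d \<or> e \<subseteq> ?B d'"
          by (auto simp: T_def AB pairs_iff)
        thus False using AB disj by blast
      qed
      have "measure_pmf.prob ?P {c. \<not> linked c A B} \<le> exp (- j * (real (card A) * real (card B)))"
      proof (rule prob_not_linked_le[OF I _ _ _ dAB])
        show "pairs (A \<union> B) \<subseteq> I"
          using pairs_mono[of "A \<union> B" "block L (Suc k) y"] sub AB Bsub by blast
        show "finite A" "finite B" using AB by (auto intro: finite_subset)
        fix u v assume uv: "u \<in> A" "v \<in> B"
        show "pmf (p {u, v}) False \<le> exp (- j)"
        proof (rule p)
          show "u \<in> block L (Suc k) y" "v \<in> block L (Suc k) y" using AB Bsub uv by blast+
          show "u (Suc k) \<noteq> v (Suc k)"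
            using block_child_digit[of u L k y d] block_child_digit[of v L k y d'] AB uv False by auto
        qed
      qed
      moreover have "exp (- j * (real (card A) * real (card B))) \<le> ?b"
        if "L ^ k \<le> 10 * card A" "L ^ k \<le> 10 * card B"
      proof -
        have "real (L ^ k) \<le> real (10 * card A)" "real (L ^ k) \<le> real (10 * card B)"
          using that by (simp_all only: of_nat_le_iff)
        hence "real L ^ k / 10 \<le> card A" "real L ^ k / 10 \<le> card B" by simp_all
        hence "real L ^ k / 10 * (real L ^ k / 10) \<le> real (card A) * real (card B)"
          by (intro mult_mono) auto
        hence "j * (real L ^ k / 10)^2 \<le> j * (real (card A) * real (card B))"
          using j by (intro mult_left_mono) (simp_all add: power2_eq_square)
        thus ?thesis by simp
      qed
      ultimately show "measure_pmf.prob ?P {c. G AB c} \<le> ?b"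
        by (cases "L ^ k \<le> 10 * card A \<and> L ^ k \<le> 10 * card B") (auto simp: G_def AB intro: order_trans)
    qed
    thus ?thesis using False by (simp add: G_def h_def)
  qed
  have "{c. core_fails L k y c} = (\<Union>d<L. \<Union>d'<L. {c. ?Q d d' c})"
    unfolding core_fails_def by auto
  hence "measure_pmf.prob ?P {c. core_fails L k y c} = measure_pmf.prob ?P (\<Union>d<L. \<Union>d'<L. {c. ?Q d d' c})"
    by (rule arg_cong)
  also have "\<dots> \<le> (\<Sum>d<L. measure_pmf.prob ?P (\<Union>d'<L. {c. ?Q d d' c}))"
    by (rule measure_pmf.finite_measure_subadditive_finite) auto
  also have "\<dots> \<le> (\<Sum>d<L. \<Sum>d'<L. measure_pmf.prob ?P {c. ?Q d d' c})"
    by (intro sum_mono measure_pmf.finite_measure_subadditive_finite) auto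
  also have "\<dots> \<le> (\<Sum>d<L. \<Sum>d'<L. ?b)"
    by (intro sum_mono pair) auto
  finally show ?thesis by (simp add: power2_eq_square mult.assoc)
qed

lemma large_core_iff:
  assumes "0 < L"
  shows "L ^ k \<le> 10 * card (core L k y c) \<longleftrightarrow> dens L k y c \<ge> 1/10"
proof -
  have "L ^ k \<le> 10 * card (core L k y c) \<longleftrightarrow> real (L ^ k) \<le> real (10 * card (core L k y c))"
    by (simp only: of_nat_le_iff)
  also have "\<dots> \<longleftrightarrow> dens L k y c \<ge> 1/10"
    using assms by (simp add: dens_def field_simps)
  finally show ?thesis .
qed

lemma dens_Suc:
  assumes L: "0 < L"
  shows "dens L (Suc k) y c = (if core_fails L k y c then 0 else
    (\<Sum>d<L. if dens L k (y(Suc k := d)) c \<ge> 1/10 then dens L k (y(Suc k := d)) c else 0) / L)"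
proof (cases "core_fails L k y c")
  case False
  let ?K = "\<lambda>d. core L k (y(Suc k := d)) c" and ?G = "{d. d < L \<and> L ^ k \<le> 10 * card (core L k (y(Suc k := d)) c)}"
  have "card (core L (Suc k) y c) = (\<Sum>d\<in>?G. card (?K d))"
    unfolding core_Suc using False
    by (simp, intro card_UN_disjoint)
       (use block_children_disjoint[of _ _ L k y] core_subset_block in \<open>auto, blast\<close>)
  hence "dens L (Suc k) y c = (\<Sum>d\<in>?G. dens L k (y(Suc k := d)) c) / L"
    using L by (simp add: dens_def sum_divide_distrib field_simps)
  also have "(\<Sum>d\<in>?G. dens L k (y(Suc k := d)) c) =
      (\<Sum>d<L. if dens L k (y(Suc k := d)) c \<ge> 1/10 then dens L k (y(Suc k := d)) c else 0)"
    by (rule sum.mono_neutral_cong_left) (auto simp: large_core_iff[OF L])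
  finally show ?thesis using False by simp
qed (simp add: dens_def core_Suc)

lemma dens_bounds: "0 \<le> dens L k y c" "0 < L \<Longrightarrow> dens L k y c \<le> 1"
proof -
  have "real (card (core L k y c)) \<le> real (L ^ k)" using card_core_le of_nat_le_iff by blast
  thus "0 < L \<Longrightarrow> dens L k y c \<le> 1" by (simp add: dens_def)
qed (simp add: dens_def)

lemma depends_dens: "depends_only_on (pairs (block L k y)) (dens L k y)"
  unfolding dens_def[abs_def] by (rule depends_only_on_comp[OF depends_core])

text \<open>Compares the new density with A, the average of the truncated densities, which it equals
  unless a link fails. The factor 81/128 is the truncation factor 81/64 halved by averaging at least
  two independent terms.\<close>

lemma dens_step:
  fixes p :: "(nat \<Rightarrow> nat) set \<Rightarrow> bool pmf" and I :: "(nat \<Rightarrow> nat) set set"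
  defines "E \<equiv> measure_pmf.expectation (Pi_pmf I False p)"
  defines "V \<equiv> \<lambda>X. measure_pmf.variance (Pi_pmf I False p) (X :: _ \<Rightarrow> real)"
  assumes L: "2 \<le> L" and I: "finite I"
    and fails: "measure_pmf.prob (Pi_pmf I False p) {c. core_fails L k y c} \<le> \<epsilon>"
    and mean: "\<And>d. d < L \<Longrightarrow> E (dens L k (y(Suc k := d))) \<ge> \<mu>" and \<mu>: "\<mu> \<ge> 9/10"
    and var: "\<And>d. d < L \<Longrightarrow> V (dens L k (y(Suc k := d))) \<le> v"
  shows "E (dens L (Suc k) y) \<ge> \<mu> - 5/32 * v - \<epsilon>" and "V (dens L (Suc k) y) \<le> 81/128 * v + \<epsilon>"
proof -
  let ?P = "Pi_pmf I False p"
  have finP: "finite (set_pmf ?P)" by (rule finite_set_Pi_pmf_bool[OF I])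
  note int[simp] = integrable_measure_pmf_finite[OF finP]
  define X where "X d c = (let r = dens L k (y(Suc k := d)) c in if r \<ge> 1/10 then r else 0)" for d c
  define A where "A c = (\<Sum>d<L. X d c) / L" for c
  define s where "s = E A"
  let ?f = "\<lambda>c. of_bool (core_fails L k y c) :: real"
  have X01: "0 \<le> X d c" "X d c \<le> 1" for d c
    using dens_bounds[of L k "y(Suc k := d)" c] L by (auto simp: X_def Let_def)
  have A01: "0 \<le> A c" "A c \<le> 1" for c
  proof -
    show "0 \<le> A c" unfolding A_def by (intro divide_nonneg_nonneg sum_nonneg X01) auto
    have "(\<Sum>d<L. X d c) \<le> (\<Sum>d<L. 1)" by (intro sum_mono X01)
    thus "A c \<le> 1" using L by (simp add: A_def)
  qed
  have s01: "0 \<le> s" "s \<le> 1"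
    unfolding s_def E_def
    by (intro Bochner_Integration.integral_nonneg measure_pmf.integral_le_const int AE_I2 A01)+
  have dA: "dens L (Suc k) y c = (if core_fails L k y c then 0 else A c)" for c
    using L by (subst dens_Suc) (simp_all add: A_def X_def Let_def)
  have Ef: "E ?f \<le> \<epsilon>"
  proof -
    have "?f = indicator {c. core_fails L k y c}" by (auto simp: indicator_def)
    thus ?thesis using fails by (simp add: E_def)
  qed
  have trunc: "E (X d) \<ge> \<mu> - 5/32 * v" "V (X d) \<le> 81/64 * v" if d: "d < L" for d
  proof -
    have *: "9/10 \<le> measure_pmf.expectation ?P (dens L k (y(Suc k := d)))"
      using mean[OF d] \<mu> by (simp add: E_def)
    note t = expectation_truncation[OF finP *]
    have Xd: "X d = (\<lambda>c. if 1/10 \<le> dens L k (y(Suc k := d)) c then dens L k (y(Suc k := d)) c else 0)"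
      by (auto simp: X_def Let_def)
    show "E (X d) \<ge> \<mu> - 5/32 * v"
      using t(2) mean[OF d] var[OF d] unfolding Xd E_def V_def by linarith
    show "V (X d) \<le> 81/64 * v"
      using t(3) var[OF d] unfolding Xd V_def by linarith
  qed
  have EA: "s = (\<Sum>d<L. E (X d)) / L"
    unfolding s_def A_def[abs_def] E_def by (simp add: Bochner_Integration.integral_sum)
  have "(\<Sum>d<L. \<mu> - 5/32 * v) \<le> (\<Sum>d<L. E (X d))"
    by (intro sum_mono trunc) simp
  hence EA': "s \<ge> \<mu> - 5/32 * v"
    using L by (simp add: EA field_simps)
  have "E (\<lambda>c. A c - ?f c) \<le> E (dens L (Suc k) y)"
    unfolding E_def by (rule integral_mono[OF int int]) (use A01 in \<open>simp add: dA\<close>)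
  moreover have "E (\<lambda>c. A c - ?f c) = s - E ?f" by (simp add: E_def s_def)
  ultimately show "E (dens L (Suc k) y) \<ge> \<mu> - 5/32 * v - \<epsilon>"
    using EA' Ef by linarith
  define Z where "Z d c = X d c - E (X d)" for d c
  have depX: "depends_only_on (pairs (block L k (y(Suc k := d)))) (X d)" for d
    unfolding X_def[abs_def] by (rule depends_only_on_comp[OF depends_dens])
  have "E (\<lambda>c. (\<Sum>d<L. Z d c)^2) = (\<Sum>d<L. E (\<lambda>c. (Z d c)^2))"
    unfolding E_def
  proof (rule second_moment_sum_orthogonal[OF finP])
    fix d d' :: nat assume "d \<noteq> d'"
    have "measure_pmf.expectation ?P (\<lambda>c. Z d c * Z d' c) =
        measure_pmf.expectation ?P (Z d) * measure_pmf.expectation ?P (Z d')"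
      unfolding Z_def[abs_def]
      by (rule expectation_Pi_pmf_mult[OF I depends_only_on_comp[OF depX] depends_only_on_comp[OF depX]
            pairs_disjoint[OF block_children_disjoint[OF \<open>d \<noteq> d'\<close>]]])
    also have "measure_pmf.expectation ?P (Z d) = 0"
      by (simp add: Z_def[abs_def] E_def)
    finally show "measure_pmf.expectation ?P (\<lambda>c. Z d c * Z d' c) = 0" by simp
  qed simp
  also have "\<dots> = (\<Sum>d<L. V (X d))" by (simp add: Z_def V_def E_def)
  also have "\<dots> \<le> (\<Sum>d<L. 81/64 * v)" by (intro sum_mono trunc) simp
  finally have sum2: "E (\<lambda>c. (\<Sum>d<L. Z d c)^2) \<le> L * (81/64 * v)" by simp
  have As: "A c - s = (\<Sum>d<L. Z d c) / L" for c
    by (simp add: A_def EA Z_def sum_subtractf diff_divide_distrib)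
  have v0: "0 \<le> v"
  proof -
    have "0 \<le> V (dens L k (y(Suc k := 0)))" by (simp add: V_def)
    also have "\<dots> \<le> v" using L by (intro var) simp
    finally show ?thesis .
  qed
  have "E (\<lambda>c. (A c - s)^2) = E (\<lambda>c. (\<Sum>d<L. Z d c)^2) / (real L)^2"
    unfolding As power_divide E_def by simp
  also have "\<dots> \<le> L * (81/64 * v) / (real L)^2"
    by (intro divide_right_mono sum2) simp
  also have "\<dots> = 81/64 * v / L" using L by (simp add: power2_eq_square)
  \<comment> \<open>The only use of L >= 2 in the contraction; the factor drops below 1
    here.\<close>
  also have "\<dots> \<le> 81/64 * v / 2" using L v0 by (intro divide_left_mono) auto
  finally have VA: "E (\<lambda>c. (A c - s)^2) \<le> 81/128 * v" by simp
  have "V (dens L (Suc k) y) \<le> E (\<lambda>c. (dens L (Suc k) y c - s)^2)"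
    unfolding V_def E_def by (rule variance_le_about[OF finP])
  also have "\<dots> \<le> E (\<lambda>c. (A c - s)^2 + ?f c)"
    unfolding E_def
  proof (rule integral_mono[OF int int])
    fix c
    \<comment> \<open>On a failure the density is 0, so its squared distance from s is at most
      1.\<close>
    have "s^2 \<le> 1" using s01 by (simp add: power_le_one)
    thus "(dens L (Suc k) y c - s)^2 \<le> (A c - s)^2 + ?f c"
      by (auto simp: dA intro: order_trans)
  qed
  also have "\<dots> = E (\<lambda>c. (A c - s)^2) + E ?f" by (simp add: E_def)
  finally show "V (dens L (Suc k) y) \<le> 81/128 * v + \<epsilon>" using VA Ef by linarith
qed

section \<open>Iteration over the scales\<close>

primrec var_bound :: "real \<Rightarrow> (nat \<Rightarrow> real) \<Rightarrow> nat \<Rightarrow> real" where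
  "var_bound \<delta> \<epsilon> 0 = \<delta>"
| "var_bound \<delta> \<epsilon> (Suc k) = 81/128 * var_bound \<delta> \<epsilon> k + \<epsilon> k"

lemma var_bound_nonneg: "0 \<le> \<delta> \<Longrightarrow> (\<And>k. 0 \<le> \<epsilon> k) \<Longrightarrow> 0 \<le> var_bound \<delta> \<epsilon> k"
  by (induction k) auto

text \<open>The recursion summed over the scales, with 47/128 = 1 - 81/128. As the terms are
  nonnegative, it bounds both the total variance and the last variance without solving the
  recursion.\<close>

lemma var_bound_sum:
  "47/128 * (\<Sum>i<k. var_bound \<delta> \<epsilon> i) + var_bound \<delta> \<epsilon> k = \<delta> + (\<Sum>i<k. \<epsilon> i)"
proof (induction k)
  case (Suc k)
  thus ?case unfolding var_bound.simps sum.lessThan_Suc by (simp add: field_simps)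
qed simp

text \<open>Both bounds form one induction, for every label z, because a step consumes the mean and
  the variance of all L children.\<close>

lemma dens_moments:
  fixes p :: "(nat \<Rightarrow> nat) set \<Rightarrow> bool pmf"
  assumes L: "2 \<le> L" and I: "finite I" and \<epsilon>0: "\<And>k. 0 \<le> \<epsilon> k" and \<delta>: "0 \<le> \<delta>" "\<delta> \<le> 1/100"
    and \<epsilon>sum: "\<And>k. (\<Sum>i<k. \<epsilon> i) \<le> \<delta>"
    and vert: "\<And>x. pmf (p {x}) False \<le> \<delta>"
    and fails: "\<And>k z. pairs (block L (Suc k) z) \<subseteq> I \<Longrightarrow>
      measure_pmf.prob (Pi_pmf I False p) {c. core_fails L k z c} \<le> \<epsilon> k"
    and sub: "pairs (block L k z) \<subseteq> I"
  shows "measure_pmf.expectation (Pi_pmf I False p) (dens L k z)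
            \<ge> 1 - \<delta> - 5/32 * (\<Sum>i<k. var_bound \<delta> \<epsilon> i) - (\<Sum>i<k. \<epsilon> i)"
    and "measure_pmf.variance (Pi_pmf I False p) (dens L k z) \<le> var_bound \<delta> \<epsilon> k"
  using sub
proof (induction k arbitrary: z)
  case 0
  let ?P = "Pi_pmf I False p"
  have finP: "finite (set_pmf ?P)" by (rule finite_set_Pi_pmf_bool[OF I])
  note int[simp] = integrable_measure_pmf_finite[OF finP]
  have zI: "{z} \<in> I" if "pairs (block L 0 z) \<subseteq> I" for z
    using that by (auto simp: pairs_def)
  have dens: "dens L 0 z = (\<lambda>c. 1 - of_bool (\<not> c {z}))" for z
  proof
    show "dens L 0 z c = 1 - of_bool (\<not> c {z})" for c
      by (cases "c {z}") (simp_all add: dens_def)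
  qed
  have notz: "measure_pmf.expectation ?P (\<lambda>c. of_bool (\<not> c {z})) \<le> \<delta>" if "{z} \<in> I" for z
  proof -
    have "measure_pmf.expectation ?P (\<lambda>c. of_bool (\<not> c {z}))
        = measure_pmf.expectation (map_pmf (\<lambda>c. c {z}) ?P) (\<lambda>b. of_bool (\<not> b) :: real)"
      by simp
    also have "map_pmf (\<lambda>c. c {z}) ?P = p {z}" using that I by (simp add: Pi_pmf_component)
    also have "measure_pmf.expectation (p {z}) (\<lambda>b. of_bool (\<not> b) :: real) = pmf (p {z}) False"
      by (subst integral_measure_pmf_real[of UNIV]) (auto simp: UNIV_bool)
    finally show ?thesis using vert by simp
  qed
  {
    case 1
    show ?case using notz[OF zI[OF 1]] by (simp add: dens)
  next
    case 2
    \<comment> \<open>Measured about 1, the squared deviation of a density with values 0 and 1 is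
      the indicator of a closed vertex.\<close>
    have "measure_pmf.variance ?P (dens L 0 z) \<le> measure_pmf.expectation ?P (\<lambda>c. (dens L 0 z c - 1)^2)"
      by (rule variance_le_about[OF finP])
    also have "\<dots> = measure_pmf.expectation ?P (\<lambda>c. of_bool (\<not> c {z}))"
      by (intro Bochner_Integration.integral_cong) (auto simp: dens)
    also have "\<dots> \<le> \<delta>" by (rule notz[OF zI[OF 2]])
    finally show ?case by simp
  }
next
  case (Suc k)
  let ?\<mu> = "1 - \<delta> - 5/32 * (\<Sum>i<k. var_bound \<delta> \<epsilon> i) - (\<Sum>i<k. \<epsilon> i)"
  have child: "pairs (block L k (z(Suc k := d))) \<subseteq> I" if "pairs (block L (Suc k) z) \<subseteq> I" "d < L" for z d
    using pairs_mono[of "block L k (z(Suc k := d))" "block L (Suc k) z"] that by auto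
  \<comment> \<open>The summed variance is at most 128/47 * 2 delta, so the total loss is at most (2
    + 40/47) delta, below 3/100.\<close>
  have "?\<mu> \<ge> 9/10"
    using var_bound_sum[of \<delta> \<epsilon> k] var_bound_nonneg[of \<delta> \<epsilon> k, OF \<delta>(1) \<epsilon>0] \<epsilon>sum[of k] \<delta> by linarith
  note step = dens_step[OF L I fails _ this]
  {
    case 1
    show ?case
      using step(1)[OF 1 Suc.IH(1)[OF child[OF 1]] Suc.IH(2)[OF child[OF 1]]]
      by (simp add: add_divide_distrib)
  next
    case 2
    show ?case
      using step(2)[OF 2 Suc.IH(1)[OF child[OF 2]] Suc.IH(2)[OF child[OF 2]]] by simp
  }
qed

definition origin_in_large_core :: "nat \<Rightarrow> nat \<Rightarrow> ((nat \<Rightarrow> nat) set \<Rightarrow> bool) \<Rightarrow> bool" where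
  "origin_in_large_core L n c \<longleftrightarrow>
     horigin \<in> core L n horigin c \<and> L ^ n \<le> 10 * card (core L n horigin c)"

text \<open>From one scale to the next the origin can leave the core only if the core of its own
  subblock is too thin or a link fails. Chebyshev and the summed variance keep the total over all
  scales, with the final density requirement, at most 11 delta.\<close>

lemma prob_origin_in_large_core:
  fixes p :: "(nat \<Rightarrow> nat) set \<Rightarrow> bool pmf"
  assumes L: "2 \<le> L" and I: "finite I" and \<epsilon>0: "\<And>k. 0 \<le> \<epsilon> k" and \<delta>: "0 \<le> \<delta>" "\<delta> \<le> 1/100"
    and \<epsilon>sum: "\<And>k. (\<Sum>i<k. \<epsilon> i) \<le> \<delta>"
    and vert: "\<And>x. pmf (p {x}) False \<le> \<delta>"
    and fails: "\<And>k z. pairs (block L (Suc k) z) \<subseteq> I \<Longrightarrow>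
      measure_pmf.prob (Pi_pmf I False p) {c. core_fails L k z c} \<le> \<epsilon> k"
    and sub: "pairs (block L n horigin) \<subseteq> I"
  shows "measure_pmf.prob (Pi_pmf I False p) {c. origin_in_large_core L n c} \<ge> 1/2"
proof -
  let ?P = "Pi_pmf I False p" and ?v = "var_bound \<delta> \<epsilon>"
  let ?D = "\<lambda>k. dens L k horigin"
  have finP: "finite (set_pmf ?P)" by (rule finite_set_Pi_pmf_bool[OF I])
  have subk: "pairs (block L k horigin) \<subseteq> I" if "k \<le> n" for k
    using that
  proof (induction k rule: inc_induct)
    case (step k)
    have "block L k (horigin(Suc k := 0)) \<subseteq> block L (Suc k) horigin"
      unfolding block.simps using L by (intro UN_upper) simp
    thus ?case using pairs_mono step by fastforce
  qed (rule sub)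
  have thin: "measure_pmf.prob ?P {c. ?D k c < 1/10} \<le> 25/16 * ?v k" if "k \<le> n" for k
  proof -
    note mom = dens_moments[OF L I \<epsilon>0 \<delta> \<epsilon>sum vert fails subk[OF that]]
    have "9/10 \<le> measure_pmf.expectation ?P (?D k)"
      using mom(1) var_bound_sum[of \<delta> \<epsilon> k] var_bound_nonneg[of \<delta> \<epsilon> k, OF \<delta>(1) \<epsilon>0] \<epsilon>sum[of k] \<delta> by linarith
    from expectation_truncation(1)[OF finP this] mom(2) show ?thesis by linarith
  qed
  have large: "L ^ k \<le> 10 * card (core L k horigin c) \<longleftrightarrow> \<not> ?D k c < 1/10" for k c
    using L by (subst large_core_iff) auto
  have out: "measure_pmf.prob ?P {c. horigin \<notin> core L k horigin c} \<le> \<delta> + 25/16 * (\<Sum>i<k. ?v i) + (\<Sum>i<k. \<epsilon> i)"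
    if "k \<le> n" for k
    using that
  proof (induction k)
    case 0
    have "{horigin} \<in> I" using subk[of 0] by (auto simp: pairs_def)
    hence "p {horigin} = map_pmf (\<lambda>c. c {horigin}) ?P" using I by (simp add: Pi_pmf_component)
    hence "pmf (p {horigin}) False = measure_pmf.prob ?P {c. \<not> c {horigin}}"
      by (simp add: pmf_map vimage_def)
    thus ?case using vert[of horigin] by simp
  next
    case (Suc k)
    \<comment> \<open>The witness is child 0: by \<open>horigin_upd\<close> its label is again
      \<open>horigin\<close>.\<close>
    have "horigin \<in> core L (Suc k) horigin c"
      if "horigin \<in> core L k horigin c" "\<not> ?D k c < 1/10" "\<not> core_fails L k horigin c" for c
      unfolding core_Suc using that L large[of k c]
      by (auto intro!: exI[of _ 0])
    hence "{c. horigin \<notin> core L (Suc k) horigin c} \<subseteq>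
       {c. horigin \<notin> core L k horigin c} \<union> {c. ?D k c < 1/10} \<union> {c. core_fails L k horigin c}" by blast
    hence "measure_pmf.prob ?P {c. horigin \<notin> core L (Suc k) horigin c} \<le>
       measure_pmf.prob ?P ({c. horigin \<notin> core L k horigin c} \<union> {c. ?D k c < 1/10} \<union> {c. core_fails L k horigin c})"
      by (rule measure_pmf.finite_measure_mono) auto
    also have "\<dots> \<le> measure_pmf.prob ?P ({c. horigin \<notin> core L k horigin c} \<union> {c. ?D k c < 1/10})
         + measure_pmf.prob ?P {c. core_fails L k horigin c}"
      by (rule measure_Un_le) auto
    also have "measure_pmf.prob ?P ({c. horigin \<notin> core L k horigin c} \<union> {c. ?D k c < 1/10})
        \<le> measure_pmf.prob ?P {c. horigin \<notin> core L k horigin c} + measure_pmf.prob ?P {c. ?D k c < 1/10}"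
      by (rule measure_Un_le) auto
    finally have "measure_pmf.prob ?P {c. horigin \<notin> core L (Suc k) horigin c} \<le>
        measure_pmf.prob ?P {c. horigin \<notin> core L k horigin c} + 25/16 * ?v k + \<epsilon> k"
      using Suc.prems fails[OF subk[OF Suc.prems]] thin[of k] by linarith
    thus ?case
      using Suc by (simp add: distrib_left)
  qed
  have "{c. \<not> origin_in_large_core L n c} \<subseteq> {c. horigin \<notin> core L n horigin c} \<union> {c. ?D n c < 1/10}"
    by (auto simp: origin_in_large_core_def large)
  hence "measure_pmf.prob ?P {c. \<not> origin_in_large_core L n c} \<le>
     measure_pmf.prob ?P ({c. horigin \<notin> core L n horigin c} \<union> {c. ?D n c < 1/10})"
    by (rule measure_pmf.finite_measure_mono) auto
  also have "\<dots> \<le> measure_pmf.prob ?P {c. horigin \<notin> core L n horigin c} + measure_pmf.prob ?P {c. ?D n c < 1/10}"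
    by (rule measure_Un_le) auto
  finally have "measure_pmf.prob ?P {c. \<not> origin_in_large_core L n c} \<le> 1/2"
    using out[of n] thin[of n] var_bound_sum[of \<delta> \<epsilon> n] var_bound_nonneg[of \<delta> \<epsilon> n, OF \<delta>(1) \<epsilon>0] \<epsilon>sum[of n] \<delta>
    by linarith
  moreover have "measure_pmf.prob ?P {c. \<not> origin_in_large_core L n c} = 1 - measure_pmf.prob ?P {c. origin_in_large_core L n c}"
    using measure_pmf.prob_compl[of "{c. origin_in_large_core L n c}" ?P] by (simp add: Compl_eq_Diff_UNIV[symmetric] Collect_neg_eq)
  ultimately show ?thesis by simp
qed

section \<open>The percolation measure\<close>

text \<open>A vertex is determined by the graph of its nonzero part, a finite subset of a countable
  set.\<close>

lemma countable_hvert: "countable (hvert L)"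
proof -
  let ?f = "\<lambda>x :: nat \<Rightarrow> nat. (\<lambda>i. (i, x i)) ` {i. x i \<noteq> 0}"
  have "inj_on ?f (hvert L)"
  proof (rule inj_onI)
    fix x y :: "nat \<Rightarrow> nat" assume eq: "?f x = ?f y"
    have "x i = y i" for i
    proof (cases "x i = 0 \<and> y i = 0")
      case False
      hence "(i, x i) \<in> ?f y \<or> (i, y i) \<in> ?f x" using eq by (metis (mono_tags, lifting) imageI mem_Collect_eq)
      thus ?thesis by auto
    qed simp
    thus "x = y" by blast
  qed
  moreover have "?f ` hvert L \<subseteq> Collect finite" by (auto simp: hvert_def)
  hence "countable (?f ` hvert L)" by (rule countable_subset) (rule countable_Collect_finite)
  ultimately show ?thesis by (rule countable_image_inj_on[rotated])
qed

lemma space_perc_law: "space (perc_law L q J) = (hvert L \<rightarrow>\<^sub>E UNIV) \<times> (hedges L \<rightarrow>\<^sub>E UNIV)"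
  by (simp add: perc_law_def space_pair_measure space_PiM)

lemma prob_space_perc_law: "prob_space (perc_law L q J)"
proof -
  interpret A: prob_space "PiM (hvert L) (\<lambda>_. measure_pmf (bernoulli_pmf q))"
    by (rule prob_space_PiM) (rule measure_pmf.prob_space_axioms)
  interpret B: prob_space "PiM (hedges L) (\<lambda>e. measure_pmf (bernoulli_pmf (1 - exp (- J e))))"
    by (rule prob_space_PiM) (rule measure_pmf.prob_space_axioms)
  interpret pair_prob_space "PiM (hvert L) (\<lambda>_. measure_pmf (bernoulli_pmf q))"
      "PiM (hedges L) (\<lambda>e. measure_pmf (bernoulli_pmf (1 - exp (- J e))))" ..
  show ?thesis unfolding perc_law_def by (rule prob_space_axioms)
qed

lemma measurable_vertex: 
  assumes "x \<in> hvert L"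
  shows "Measurable.pred (perc_law L q J) (\<lambda>z. fst z x)"
proof -
  have "(\<lambda>z. fst z x) \<in> perc_law L q J \<rightarrow>\<^sub>M measure_pmf (bernoulli_pmf q)"
    unfolding perc_law_def by (rule measurable_compose[OF measurable_fst measurable_component_singleton[OF assms]])
  thus ?thesis by (simp add: measurable_def pred_def)
qed

lemma measurable_edge: 
  assumes "e \<in> hedges L"
  shows "Measurable.pred (perc_law L q J) (\<lambda>z. snd z e)"
proof -
  have "(\<lambda>z. snd z e) \<in> perc_law L q J \<rightarrow>\<^sub>M measure_pmf (bernoulli_pmf (1 - exp (- J e)))"
    unfolding perc_law_def by (rule measurable_compose[OF measurable_snd measurable_component_singleton[OF assms]])
  thus ?thesis by (simp add: measurable_def pred_def)
qed

lemma hedges_vertex: "{u, v} \<in> hedges L \<Longrightarrow> u \<in> hvert L" "{u, v} \<in> hedges L \<Longrightarrow> v \<in> hvert L"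
  by (auto simp: hedges_def doubleton_eq_iff)

lemma measurable_open_edge: "Measurable.pred (perc_law L q J) (\<lambda>z. open_edge L (fst z) (snd z) {u, v})"
proof (cases "{u, v} \<in> hedges L")
  case True
  note [measurable] = measurable_edge[OF True] measurable_vertex[OF hedges_vertex(1)[OF True]]
    measurable_vertex[OF hedges_vertex(2)[OF True]]
  show ?thesis unfolding open_edge_def using True by simp
qed (simp add: open_edge_def)

lemma pred_countable_Bex:
  "countable X \<Longrightarrow> (\<And>i. i \<in> X \<Longrightarrow> Measurable.pred M (\<lambda>x. P x i)) \<Longrightarrow>
    Measurable.pred M (\<lambda>x. \<exists>i\<in>X. P x i)"
  unfolding pred_def by (rule sets.sets_Collect_countable_Ex')

text \<open>The last intermediate vertex of a path ranges over the countable set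
  \<open>hvert L\<close>, since open edges have their endpoints there.\<close>

lemma measurable_relpow_open:
  "Measurable.pred (perc_law L q J) (\<lambda>z. (x, y) \<in> {(u, v). open_edge L (fst z) (snd z) {u, v}} ^^ n)"
proof (induction n arbitrary: y)
  case (Suc n)
  have "(x, y) \<in> {(u, v). open_edge L (fst z) (snd z) {u, v}} ^^ Suc n \<longleftrightarrow>
      (\<exists>w\<in>hvert L. (x, w) \<in> {(u, v). open_edge L (fst z) (snd z) {u, v}} ^^ n \<and> open_edge L (fst z) (snd z) {w, y})" for z
    by (auto simp: open_edge_def dest: hedges_vertex)
  moreover have "Measurable.pred (perc_law L q J) (\<lambda>z.
      \<exists>w\<in>hvert L. (x, w) \<in> {(u, v). open_edge L (fst z) (snd z) {u, v}} ^^ n \<and> open_edge L (fst z) (snd z) {w, y})"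
    by (intro pred_countable_Bex countable_hvert pred_intros_logic Suc.IH measurable_open_edge)
  ultimately show ?case by presburger
qed simp

lemma measurable_cluster0:
  assumes "0 < L"
  shows "Measurable.pred (perc_law L q J) (\<lambda>z. y \<in> cluster0 L (fst z) (snd z))"
  unfolding cluster0_def mem_Collect_eq rtrancl_is_UN_relpow UN_iff
  by (intro pred_intros_logic measurable_vertex horigin_in_hvert[OF assms]
        pred_intros_countable_bounded measurable_relpow_open)

lemma cluster0_subset_hvert: "0 < L \<Longrightarrow> cluster0 L \<omega> \<eta> \<subseteq> hvert L"
proof
  fix y assume "0 < L" "y \<in> cluster0 L \<omega> \<eta>"
  hence "(horigin, y) \<in> {(u, v). open_edge L \<omega> \<eta> {u, v}}\<^sup>*" by (simp add: cluster0_def)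
  thus "y \<in> hvert L"
    by (induction rule: rtrancl_induct)
       (use horigin_in_hvert[OF \<open>0 < L\<close>] in \<open>auto simp: open_edge_def dest: hedges_vertex\<close>)
qed

text \<open>Merges sites and bonds into one predicate. It is false off \<open>pairs V\<close>,
  matching the default value of \<open>Pi_pmf\<close>.\<close>

definition config_on :: "(nat \<Rightarrow> nat) set \<Rightarrow> ((nat \<Rightarrow> nat) \<Rightarrow> bool) \<times> ((nat \<Rightarrow> nat) set \<Rightarrow> bool)
    \<Rightarrow> (nat \<Rightarrow> nat) set \<Rightarrow> bool" where
  "config_on V z e \<longleftrightarrow> e \<in> pairs V \<and> (if card e = 1 then fst z (the_elem e) else snd z e)"

definition site_bond_pmf :: "real \<Rightarrow> ((nat \<Rightarrow> nat) set \<Rightarrow> real) \<Rightarrow> (nat \<Rightarrow> nat) set \<Rightarrow> bool pmf" where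
  "site_bond_pmf q J e = bernoulli_pmf (if card e = 1 then q else 1 - exp (- J e))"

text \<open>Restricting to V only closes vertices and edges, so every connection found inside the
  box persists in the full graph.\<close>

lemma core_subset_cluster0:
  assumes V: "V \<subseteq> hvert L" and o: "horigin \<in> core L n horigin (config_on V z)"
  shows "core L n horigin (config_on V z) \<subseteq> cluster0 L (fst z) (snd z)"
proof
  fix y assume y: "y \<in> core L n horigin (config_on V z)"
  let ?c = "config_on V z"
  have "open_step ?c \<subseteq> {(u, v). open_edge L (fst z) (snd z) {u, v}}"
  proof clarify
    fix u v assume "(u, v) \<in> open_step ?c"
    hence uv: "u \<noteq> v" "?c {u, v}" "?c {u}" "?c {v}" by (auto simp: open_step_def)
    hence "u \<in> hvert L" "v \<in> hvert L" using V by (auto simp: config_on_def pairs_def)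
    thus "open_edge L (fst z) (snd z) {u, v}"
      using uv by (auto simp: open_edge_def config_on_def hedges_def)
  qed
  moreover have "(horigin, y) \<in> (open_step ?c)\<^sup>*" "?c {horigin}"
    using core_connected[OF o] y by blast+
  ultimately show "y \<in> cluster0 L (fst z) (snd z)"
    using rtrancl_mono by (auto simp: cluster0_def config_on_def)
qed

text \<open>Prescribing the configuration in V fixes finitely many vertex coordinates and finitely
  many edge coordinates: a product of two cylinders, whose masses multiply to the value of the
  finite product law.\<close>

lemma perc_law_config_eq:
  fixes q :: real and J :: "(nat \<Rightarrow> nat) set \<Rightarrow> real"
  assumes V: "V \<subseteq> hvert L" "finite V" and c: "\<And>e. e \<notin> pairs V \<Longrightarrow> \<not> c e"
  defines "S \<equiv> {z \<in> space (perc_law L q J). config_on V z = c}"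
  shows "S \<in> sets (perc_law L q J)"
    and "measure (perc_law L q J) S = pmf (Pi_pmf (pairs V) False (site_bond_pmf q J)) c"
proof -
  let ?A = "\<lambda>_ :: nat \<Rightarrow> nat. measure_pmf (bernoulli_pmf q)" and ?B = "\<lambda>e. measure_pmf (bernoulli_pmf (1 - exp (- J e)))"
  interpret A: product_prob_space ?A "hvert L" ..
  interpret B: product_prob_space ?B "hedges L" ..
  let ?E = "{e \<in> pairs V. card e = 2}" and ?T = "(\<lambda>x. {x}) ` V"
  let ?XA = "prod_emb (hvert L) ?A V (\<Pi>\<^sub>E x\<in>V. {c {x}})"
  let ?XB = "prod_emb (hedges L) ?B ?E (\<Pi>\<^sub>E e\<in>?E. {c e})"
  have finE: "finite ?E" using finite_pairs[OF V(2)] by simp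
  have Esub: "?E \<subseteq> hedges L"
    using V by (auto simp: pairs_def hedges_def card_2_iff doubleton_eq_iff) (use V in blast)+
  have "e \<in> ?T \<union> ?E" if "e \<in> pairs V" for e
  proof -
    from that obtain u v where "u \<in> V" "v \<in> V" "e = {u, v}" by (auto simp: pairs_def)
    with that show ?thesis by (cases "u = v") auto
  qed
  moreover have "?T \<subseteq> pairs V" by (auto simp: pairs_def)
  ultimately have pairs: "pairs V = ?T \<union> ?E" "?T \<inter> ?E = {}" by auto
  have "config_on V z = c \<longleftrightarrow> (\<forall>x\<in>V. fst z x = c {x}) \<and> (\<forall>e\<in>?E. snd z e = c e)" for z
  proof -
    have "config_on V z = c \<longleftrightarrow> (\<forall>e\<in>pairs V. config_on V z e = c e)"
      using c by (auto simp: fun_eq_iff config_on_def)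
    also have "\<dots> \<longleftrightarrow> (\<forall>e\<in>?T. config_on V z e = c e) \<and> (\<forall>e\<in>?E. config_on V z e = c e)"
      by (subst pairs(1)) blast
    also have "(\<forall>e\<in>?T. config_on V z e = c e) \<longleftrightarrow> (\<forall>x\<in>V. fst z x = c {x})"
      by (auto simp: config_on_def pairs_def)
    also have "(\<forall>e\<in>?E. config_on V z e = c e) \<longleftrightarrow> (\<forall>e\<in>?E. snd z e = c e)"
      by (auto simp: config_on_def)
    finally show ?thesis .
  qed
  hence S: "S = ?XA \<times> ?XB"
    unfolding S_def space_perc_law prod_emb_def using V Esub
    by (auto simp: PiE_iff space_PiM restrict_def)
  have sets: "?XA \<in> sets (PiM (hvert L) ?A)" "?XB \<in> sets (PiM (hedges L) ?B)"
    using V finE Esub by (auto intro!: sets_PiM_I)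
  show "S \<in> sets (perc_law L q J)" unfolding S perc_law_def using sets by simp
  have "measure (perc_law L q J) S = measure (PiM (hvert L) ?A) ?XA * measure (PiM (hedges L) ?B) ?XB"
    unfolding S perc_law_def measure_def by (simp add: B.P.emeasure_pair_measure_Times sets enn2real_mult)
  also have "measure (PiM (hvert L) ?A) ?XA = (\<Prod>x\<in>V. pmf (bernoulli_pmf q) (c {x}))"
    using A.measure_PiM_emb[OF V(1,2)] by (simp add: measure_pmf_single)
  also have "\<dots> = (\<Prod>e\<in>?T. pmf (site_bond_pmf q J e) (c e))"
    by (subst prod.reindex) (auto simp: site_bond_pmf_def)
  also have "measure (PiM (hedges L) ?B) ?XB = (\<Prod>e\<in>?E. pmf (site_bond_pmf q J e) (c e))"
    using B.measure_PiM_emb[OF Esub finE] by (simp add: measure_pmf_single site_bond_pmf_def)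
  also have "(\<Prod>e\<in>?T. pmf (site_bond_pmf q J e) (c e)) * (\<Prod>e\<in>?E. pmf (site_bond_pmf q J e) (c e))
      = (\<Prod>e\<in>pairs V. pmf (site_bond_pmf q J e) (c e))"
    using prod.union_disjoint[OF finite_imageI[OF V(2)] finE pairs(2), of "\<lambda>e. pmf (site_bond_pmf q J e) (c e)"]
    unfolding pairs(1)[symmetric] by simp
  also have "\<dots> = pmf (Pi_pmf (pairs V) False (site_bond_pmf q J)) c"
    using c by (subst pmf_Pi'[OF finite_pairs[OF V(2)]]) auto
  finally show "measure (perc_law L q J) S = pmf (Pi_pmf (pairs V) False (site_bond_pmf q J)) c" .
qed

text \<open>A box event is a finite disjoint union of such cylinders; this carries the finite
  estimates over to the lattice.\<close>

lemma perc_law_config: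
  assumes V: "V \<subseteq> hvert L" "finite V"
  shows "measure (perc_law L q J) {z \<in> space (perc_law L q J). Q (config_on V z)}
       = measure_pmf.prob (Pi_pmf (pairs V) False (site_bond_pmf q J)) {c. Q c}"
proof -
  let ?M = "perc_law L q J"
  interpret prob_space ?M by (rule prob_space_perc_law)
  let ?C = "{c. Q c \<and> (\<forall>e. e \<notin> pairs V \<longrightarrow> \<not> c e)}"
  let ?S = "\<lambda>c. {z \<in> space ?M. config_on V z = c}"
  have fin: "finite ?C"
    by (rule finite_subset[OF _ finite_PiE_dflt[of "pairs V" "\<lambda>_. UNIV" False]])
       (auto simp: PiE_dflt_def finite_pairs[OF V(2)])
  have eq: "{z \<in> space ?M. Q (config_on V z)} = (\<Union>c\<in>?C. ?S c)"
    by (auto simp: config_on_def)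
  have "measure ?M (\<Union>c\<in>?C. ?S c) = (\<Sum>c\<in>?C. measure ?M (?S c))"
    by (rule finite_measure_finite_Union[OF fin])
       (auto simp: disjoint_family_on_def intro!: perc_law_config_eq(1) V)
  also have "\<dots> = (\<Sum>c\<in>?C. pmf (Pi_pmf (pairs V) False (site_bond_pmf q J)) c)"
    by (intro sum.cong refl perc_law_config_eq(2) V) auto
  also have "\<dots> = measure_pmf.prob (Pi_pmf (pairs V) False (site_bond_pmf q J)) ?C"
    by (rule measure_measure_pmf_finite[OF fin, symmetric])
  \<comment> \<open>Configurations that are true somewhere off \<open>pairs V\<close> have mass
    0.\<close>
  also have "\<dots> = measure_pmf.prob (Pi_pmf (pairs V) False (site_bond_pmf q J)) {c. Q c}"
    by (rule measure_prob_cong_0) (auto intro!: pmf_Pi_outside finite_pairs V)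
  finally show "measure ?M {z \<in> space ?M. Q (config_on V z)}
       = measure_pmf.prob (Pi_pmf (pairs V) False (site_bond_pmf q J)) {c. Q c}"
    unfolding eq .
qed

section \<open>The infinite cluster\<close>

text \<open>The finite-box bound 1/2 is the same on every scale, so it survives the decreasing limit
  of the events |K_0| >= n.\<close>

lemma prob_infinite_cluster:
  assumes L: "2 \<le> L" and J0: "\<And>e. e \<in> hedges L \<Longrightarrow> 0 \<le> J e"
    and \<delta>: "0 \<le> \<delta>" "\<delta> \<le> 1/100" and q: "1 - \<delta> \<le> q" "q \<le> 1"
    and j0: "\<And>k. 0 \<le> j k" and Jj: "\<And>e k. e \<in> hedges L \<Longrightarrow> elen L e = real L ^ Suc k \<Longrightarrow> J e = j k"
    and sum: "\<And>n. (\<Sum>k<n. (real L)^2 * exp (- j k * (real L ^ k / 10)^2)) \<le> \<delta>"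
  shows "1/2 \<le> measure (perc_law L q J)
      {(\<omega>, \<eta>) \<in> space (perc_law L q J). infinite (cluster0 L \<omega> \<eta>)}"
proof -
  let ?M = "perc_law L q J" and ?C = "\<lambda>z. cluster0 L (fst z) (snd z)"
  interpret prob_space ?M by (rule prob_space_perc_law)
  have L0: "0 < L" using L by simp
  \<comment> \<open>Witness sets of size n form a countable family, which makes |K_0| >= n
    measurable.\<close>
  define Fin where "Fin n = {F. F \<subseteq> hvert L \<and> finite F \<and> card F = n}" for n
  define B where "B n = {z \<in> space ?M. \<exists>F\<in>Fin n. \<forall>y\<in>F. y \<in> ?C z}" for n
  have cnt: "countable (Fin n)" for n
    by (rule countable_subset[OF _ countable_Collect_finite_subset[OF countable_hvert[of L]]])
       (auto simp: Fin_def)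
  have B_sets: "B n \<in> sets ?M" for n
  proof -
    have "Measurable.pred ?M (\<lambda>z. \<exists>F\<in>Fin n. \<forall>y\<in>F. y \<in> ?C z)"
      by (intro pred_countable_Bex cnt pred_intros_finite measurable_cluster0[OF L0])
         (auto simp: Fin_def)
    thus ?thesis by (simp add: B_def pred_def)
  qed
  have B_dec: "decseq B"
  proof (rule decseq_SucI, rule subsetI)
    fix n z assume "z \<in> B (Suc n)"
    then obtain F where F: "z \<in> space ?M" "F \<in> Fin (Suc n)" "\<forall>y\<in>F. y \<in> ?C z" by (auto simp: B_def)
    then obtain x G where "F = insert x G" "x \<notin> G" "card G = n"
      unfolding Fin_def by (auto simp: card_Suc_eq)
    with F have "G \<in> Fin n" "\<forall>y\<in>G. y \<in> ?C z" by (auto simp: Fin_def)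
    with F(1) show "z \<in> B n" unfolding B_def by blast
  qed
  have inf_eq: "{(\<omega>, \<eta>) \<in> space ?M. infinite (cluster0 L \<omega> \<eta>)} = (\<Inter>n. B n)"
  proof (intro equalityI subsetI)
    fix z assume "z \<in> {(\<omega>, \<eta>) \<in> space ?M. infinite (cluster0 L \<omega> \<eta>)}"
    hence z: "z \<in> space ?M" "infinite (?C z)" by auto
    have "z \<in> B n" for n
    proof -
      obtain F where "F \<subseteq> ?C z" "finite F" "card F = n"
        using infinite_arbitrarily_large[OF z(2)] by blast
      thus ?thesis using z(1) cluster0_subset_hvert[OF L0] unfolding B_def Fin_def by blast
    qed
    thus "z \<in> (\<Inter>n. B n)" by blast
  next
    fix z assume z: "z \<in> (\<Inter>n. B n)"
    have "infinite (?C z)"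
    proof
      assume fin: "finite (?C z)"
      from z have "z \<in> B (Suc (card (?C z)))" by blast
      then obtain F where "F \<subseteq> ?C z" "card F = Suc (card (?C z))" by (auto simp: B_def Fin_def)
      thus False using card_mono[OF fin, of F] by linarith
    qed
    moreover have "z \<in> space ?M" using z by (auto simp: B_def)
    ultimately show "z \<in> {(\<omega>, \<eta>) \<in> space ?M. infinite (cluster0 L \<omega> \<eta>)}" by (auto simp: case_prod_beta)
  qed
  have B_prob: "1/2 \<le> prob (B n)" for n
  proof -
    \<comment> \<open>A core of density at least 1/10 in a block of this scale has at least n
      vertices.\<close>
    obtain m where m: "10 * n \<le> L ^ m"
    proof
      have "10 * n < 2 ^ (10 * n)" by (rule less_exp)
      also have "\<dots> \<le> L ^ (10 * n)" using L by (intro power_mono) auto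
      finally show "10 * n \<le> L ^ (10 * n)" by simp
    qed
    let ?V = "block L m horigin" and ?p = "site_bond_pmf q J"
    have V: "?V \<subseteq> hvert L" "finite ?V"
      using block_subset_hvert[OF horigin_in_hvert[OF L0]] by auto
    let ?\<epsilon> = "\<lambda>k. (real L)^2 * exp (- j k * (real L ^ k / 10)^2)"
    have q0: "0 \<le> q" using \<delta> q by linarith
    have "1/2 \<le> measure_pmf.prob (Pi_pmf (pairs ?V) False ?p) {c. origin_in_large_core L m c}"
    proof (rule prob_origin_in_large_core[OF L finite_pairs[OF V(2)] _ \<delta> sum])
      show "0 \<le> ?\<epsilon> k" for k by simp
      show "pmf (?p {x}) False \<le> \<delta>" for x
        using q q0 by (simp add: site_bond_pmf_def)
      show "measure_pmf.prob (Pi_pmf (pairs ?V) False ?p) {c. core_fails L k z c} \<le> ?\<epsilon> k"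
        if sub: "pairs (block L (Suc k) z) \<subseteq> pairs ?V" for k z
      proof (rule prob_core_fails_le[OF finite_pairs[OF V(2)] sub j0])
        fix u v assume uv: "u \<in> block L (Suc k) z" "v \<in> block L (Suc k) z" "u (Suc k) \<noteq> v (Suc k)"
        hence ne: "u \<noteq> v" by auto
        have "{u, v} \<in> pairs (block L (Suc k) z)" using uv unfolding pairs_def by blast
        hence "{u, v} \<in> pairs ?V" using sub by blast
        hence e: "{u, v} \<in> hedges L" using V ne by (auto simp: pairs_iff hedges_def)
        moreover have "elen L {u, v} = real L ^ Suc k"
          unfolding elen_doubleton by (rule hdist_children[OF uv])
        ultimately have "J {u, v} = j k" by (rule Jj)
        thus "pmf (?p {u, v}) False \<le> exp (- j k)"
          using ne j0[of k] by (simp add: site_bond_pmf_def)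
      qed
    qed simp
    also have "\<dots> = prob {z \<in> space ?M. origin_in_large_core L m (config_on ?V z)}"
      by (rule perc_law_config[OF V, symmetric])
    also have "\<dots> \<le> prob (B n)"
    proof (rule finite_measure_mono[OF _ B_sets], rule subsetI)
      fix z assume "z \<in> {z \<in> space ?M. origin_in_large_core L m (config_on ?V z)}"
      hence z: "z \<in> space ?M" and c: "horigin \<in> core L m horigin (config_on ?V z)"
        "L ^ m \<le> 10 * card (core L m horigin (config_on ?V z))"
        by (auto simp: origin_in_large_core_def)
      have "n \<le> card (core L m horigin (config_on ?V z))" using c(2) m by linarith
      then obtain F where F: "F \<subseteq> core L m horigin (config_on ?V z)" "card F = n" "finite F"
        by (rule obtain_subset_with_card_n)
      hence "F \<subseteq> ?C z" using core_subset_cluster0[OF V(1) c(1)] by blast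
      moreover from this have "F \<in> Fin n"
        using F(2,3) cluster0_subset_hvert[OF L0, of "fst z" "snd z"] by (auto simp: Fin_def)
      ultimately show "z \<in> B n" using z unfolding B_def by blast
    qed
    finally show ?thesis .
  qed
  have "(\<lambda>n. prob (B n)) \<longlonglongrightarrow> prob (\<Inter>n. B n)"
    by (rule finite_Lim_measure_decseq) (use B_sets B_dec in auto)
  hence "1/2 \<le> prob (\<Inter>n. B n)"
    by (rule LIMSEQ_le_const) (use B_prob in auto)
  thus ?thesis unfolding inf_eq .
qed

section \<open>Choice of the kernel and summability of its failure probabilities\<close>

lemma exp_minus_two_ln: "0 < x \<Longrightarrow> exp (- (2 * ln x)) = inverse (x^2)" for x :: real
  by (simp add: exp_minus exp_double)

text \<open>N is chosen before the sequence e, because the kernel, and with it e, can only be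
  defined once N is known. Half of delta pays for the scales below N, half for the tail.\<close>

lemma failure_sum_le:
  assumes C: "0 \<le> C" and \<delta>: "0 < \<delta>"
  shows "\<exists>N\<ge>1. \<forall>e. (\<forall>k<N. e k \<le> \<delta> / (2 * real N)) \<longrightarrow>
     (\<forall>k\<ge>N. e k \<le> C * inverse (real (Suc k) ^ 2)) \<longrightarrow> (\<forall>n. (\<Sum>k<n. e k) \<le> \<delta>)"
proof -
  let ?f = "\<lambda>k. C * inverse (real (Suc k) ^ 2)"
  have "summable (\<lambda>n. inverse (real n ^ 2))" by (rule inverse_power_summable) simp
  hence summ: "summable ?f"
    by (intro summable_mult) (subst summable_Suc_iff[where f = "\<lambda>n. inverse (real n ^ 2)"])
  obtain N0 where N0: "\<And>n. n \<ge> N0 \<Longrightarrow> norm (\<Sum>i. ?f (i + n)) < \<delta> / 2"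
    using suminf_exist_split[OF _ summ, of "\<delta> / 2"] \<delta> by auto
  define N where "N = max 1 N0"
  show ?thesis
  proof (intro exI[of _ N] conjI allI impI)
    show "1 \<le> N" by (simp add: N_def)
    fix e :: "nat \<Rightarrow> real" and n
    assume e1: "\<forall>k<N. e k \<le> \<delta> / (2 * real N)" and e2: "\<forall>k\<ge>N. e k \<le> ?f k"
    have "(\<Sum>k<n. e k) \<le> (\<Sum>k<n. (if k < N then \<delta> / (2 * real N) else 0) + (if N \<le> k then ?f k else 0))"
      by (intro sum_mono) (use e1 e2 in auto)
    also have "\<dots> = (\<Sum>k<n. (if k < N then \<delta> / (2 * real N) else 0)) + (\<Sum>k<n. if N \<le> k then ?f k else 0)"
      by (rule sum.distrib)
    also have "\<dots> \<le> \<delta> / 2 + \<delta> / 2"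
    proof (rule add_mono)
      have "(\<Sum>k<n. (if k < N then \<delta> / (2 * real N) else 0)) = (\<Sum>k\<in>{..<n} \<inter> {..<N}. \<delta> / (2 * real N))"
        by (subst sum.inter_restrict) auto
      also have "\<dots> \<le> (\<Sum>k<N. \<delta> / (2 * real N))"
        by (rule sum_mono2) (use \<delta> in auto)
      also have "\<dots> = \<delta> / 2" by (simp add: N_def)
      finally show "(\<Sum>k<n. (if k < N then \<delta> / (2 * real N) else 0)) \<le> \<delta> / 2" .
      \<comment> \<open>Enlarging the range to n + N allows the shift by N even when n < N.\<close>
      have "(\<Sum>k<n. if N \<le> k then ?f k else 0) \<le> (\<Sum>k<n+N. if N \<le> k then ?f k else 0)"
        by (rule sum_mono2) (use C in auto)
      also have "\<dots> = (\<Sum>k\<in>{N..<n+N}. ?f k)"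
        by (rule sum.mono_neutral_cong_right) auto
      also have "\<dots> = (\<Sum>i<n. ?f (i + N))"
        using sum.shift_bounds_nat_ivl[of ?f 0 N n] by (simp add: atLeast0LessThan)
      also have "\<dots> \<le> (\<Sum>i. ?f (i + N))"
        by (rule sum_le_suminf[OF summable_ignore_initial_segment[OF summ]]) (use C in auto)
      also have "\<dots> \<le> \<delta> / 2" using N0[of N] by (simp add: N_def)
      finally show "(\<Sum>k<n. if N \<le> k then ?f k else 0) \<le> \<delta> / 2" .
    qed
    finally show "(\<Sum>k<n. e k) \<le> \<delta>" by simp
  qed
qed

theorem theorem2p1:
  fixes L :: nat and a :: real
  assumes "L \<ge> 2" and "a > 200 * real L"
  shows "\<exists>q J. 0 < q \<and> q < 1 \<and>
           (\<forall>e\<in>hedges L. 0 \<le> J e) \<and>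
           isometry_invariant L J \<and>
           kernel_asymp L J (\<lambda>n. a * real L * n powr (-2) * ln (ln n)) \<and>
           measure (perc_law L q J)
             {(\<omega>, \<eta>) \<in> space (perc_law L q J). infinite (cluster0 L \<omega> \<eta>)} > 0"
proof -
  let ?g = "\<lambda>n. a * real L * n powr (-2) * ln (ln n)"
  define \<delta> :: real where "\<delta> = 1/100"
  \<comment> \<open>The tail failure bound is L^2 * ((k + 1) ln L)^(-2); C collects its
    constants.\<close>
  define C where "C = (real L)^2 / (ln L)^2"
  have L1: "1 < real L" using assms by simp
  have a0: "0 < a" using assms by (smt (verit) mult_nonneg_nonneg of_nat_0_le_iff)
  have lnL: "0 < ln (real L)" using L1 by simp
  have "0 \<le> C" "0 < \<delta>" by (simp_all add: C_def \<delta>_def)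
  from failure_sum_le[OF this] obtain N :: nat where N1: "1 \<le> N" and
    N: "\<forall>e. (\<forall>k<N. e k \<le> \<delta> / (2 * real N)) \<longrightarrow>
     (\<forall>k\<ge>N. e k \<le> C * inverse (real (Suc k) ^ 2)) \<longrightarrow> (\<forall>n. (\<Sum>k<n. e k) \<le> \<delta>)"
    by auto
  \<comment> \<open>As (L^k / 10)^2 >= 1/100, this value makes L^2 * exp(- M / 100) at most delta /
    (2 N); the maximum with 0 keeps the kernel nonnegative.\<close>
  define M where "M = 100 * max 0 (ln (2 * real N * (real L)^2 / \<delta>))"
  \<comment> \<open>Edges of scale k have length L^(k+1), so k < N means length below L^(N+1). From
    that length on the kernel equals its asymptotic form exactly.\<close>
  define jf where "jf n = (if n < real L ^ Suc N then M else ?g n)" for n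
  define J where "J e = jf (elen L e)" for e
  \<comment> \<open>Makes ln (ln n) positive for n >= 4, hence on all lengths from L^(N+1) on, as N
    >= 1: there the kernel is positive and division by its asymptotic form is legitimate.\<close>
  have ln4: "1 < ln (4 :: real)"
  proof -
    have "exp 1 < (4 :: real)" using exp_le by linarith
    hence "ln (exp 1) < ln (4 :: real)" by (subst ln_less_cancel_iff) auto
    thus ?thesis by simp
  qed
  have big: "4 \<le> real L ^ k" if "2 \<le> k" for k
  proof -
    have "(4 :: real) = 2 ^ 2" by simp
    also have "\<dots> \<le> real L ^ 2" using assms by (intro power_mono) auto
    also have "\<dots> \<le> real L ^ k" using that L1 by (intro power_increasing) auto
    finally show ?thesis .
  qed
  have lnln: "0 < ln (ln n)" if "4 \<le> n" for n :: real
  proof -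
    have "ln 4 \<le> ln n" using that by simp
    thus ?thesis using ln4 by simp
  qed
  have g_pos: "0 < ?g n" if "4 \<le> n" for n
    using lnln[OF that] a0 L1 that by simp
  have M0: "0 \<le> M" by (simp add: M_def)
  have jf0: "0 \<le> jf n" for n
    using g_pos[of n] big[of "Suc N"] N1 M0 by (auto simp: jf_def less_imp_le)
  have asymp: "kernel_asymp L J ?g"
    unfolding kernel_asymp_def
  proof (intro allI impI exI ballI)
    fix \<epsilon> :: real and e assume "0 < \<epsilon>" and e: "real L ^ Suc N \<le> elen L e"
    hence "J e = ?g (elen L e)" by (simp add: J_def jf_def)
    moreover have "0 < ?g (elen L e)" using g_pos[of "elen L e"] big[of "Suc N"] N1 e by simp
    ultimately have "J e / ?g (elen L e) = 1" by (metis divide_self less_irrefl)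
    thus "\<bar>J e / ?g (elen L e) - 1\<bar> < \<epsilon>"
      using \<open>0 < \<epsilon>\<close> by (simp only: diff_self abs_zero)
  qed
  have sum: "(\<Sum>k<n. (real L)^2 * exp (- jf (real L ^ Suc k) * (real L ^ k / 10)^2)) \<le> \<delta>" for n
  proof (rule N[rule_format])
    fix k assume k: "k < N"
    have "real L ^ Suc k < real L ^ Suc N" using k L1 by (intro power_strict_increasing) auto
    hence jf: "jf (real L ^ Suc k) = M" by (simp add: jf_def)
    have "(1/10)^2 \<le> (real L ^ k / 10)^2" using L1 by (intro power_mono) auto
    hence "M * (1/100) \<le> M * (real L ^ k / 10)^2"
      using M0 by (intro mult_left_mono) (auto simp: power_divide)
    moreover have "ln (2 * real N * (real L)^2 / \<delta>) \<le> M * (1/100)" by (simp add: M_def)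
    ultimately have "exp (- M * (real L ^ k / 10)^2) \<le> exp (- ln (2 * real N * (real L)^2 / \<delta>))" by simp
    also have "\<dots> = \<delta> / (2 * real N * (real L)^2)"
      using L1 N1 by (simp add: exp_minus \<delta>_def inverse_eq_divide)
    finally have "(real L)^2 * exp (- M * (real L ^ k / 10)^2) \<le> (real L)^2 * (\<delta> / (2 * real N * (real L)^2))"
      by (intro mult_left_mono) auto
    also have "\<dots> = \<delta> / (2 * real N)" using L1 by (simp add: field_simps)
    finally show "(real L)^2 * exp (- jf (real L ^ Suc k) * (real L ^ k / 10)^2) \<le> \<delta> / (2 * real N)"
      unfolding jf .
  next
    fix k assume k: "N \<le> k"
    let ?x = "real (Suc k) * ln L"
    have "real L ^ Suc N \<le> real L ^ Suc k" using k L1 by (intro power_increasing) auto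
    hence jf: "jf (real L ^ Suc k) = ?g (real L ^ Suc k)" by (simp add: jf_def)
    have x: "ln (real L ^ Suc k) = ?x" using L1 by (simp only: ln_realpow)
    have lnx: "0 < ln ?x" using lnln[OF big[of "Suc k"]] k N1 unfolding x by simp
    have "(real L ^ Suc k) powr (-2) = inverse ((real L ^ Suc k)^2)"
      using L1 by (simp add: powr_minus)
    hence "jf (real L ^ Suc k) * (real L ^ k / 10)^2 = a * real L * inverse ((real L ^ Suc k)^2) * ln ?x * (real L ^ k / 10)^2"
      unfolding jf x by simp
    also have "\<dots> = a / (100 * real L) * ln ?x"
      using L1 by (simp add: field_simps power2_eq_square)
    also have "\<dots> \<ge> 2 * ln ?x" \<comment> \<open>200 = 2 * 10^2: twice the inverse square of the density threshold\<close>
      using assms L1 lnx by (intro mult_right_mono) (auto simp: field_simps)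
    finally have "exp (- jf (real L ^ Suc k) * (real L ^ k / 10)^2) \<le> exp (- (2 * ln ?x))" by simp
    also have "\<dots> = inverse (?x^2)" by (rule exp_minus_two_ln) (use lnL in simp)
    finally have "(real L)^2 * exp (- jf (real L ^ Suc k) * (real L ^ k / 10)^2) \<le> (real L)^2 * inverse (?x^2)"
      by (intro mult_left_mono) auto
    also have "\<dots> = C * inverse (real (Suc k) ^ 2)"
      by (simp only: C_def power_mult_distrib inverse_mult_distrib divide_inverse mult_ac)
    finally show "(real L)^2 * exp (- jf (real L ^ Suc k) * (real L ^ k / 10)^2) \<le> C * inverse (real (Suc k) ^ 2)" .
  qed
  have "1/2 \<le> measure (perc_law L (1 - \<delta>) J)
      {(\<omega>, \<eta>) \<in> space (perc_law L (1 - \<delta>) J). infinite (cluster0 L \<omega> \<eta>)}"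
    by (rule prob_infinite_cluster[where \<delta> = \<delta> and j = "\<lambda>k. jf (real L ^ Suc k)"])
       (use assms sum jf0 in \<open>auto simp: J_def \<delta>_def\<close>)
  hence "0 < measure (perc_law L (1 - \<delta>) J)
      {(\<omega>, \<eta>) \<in> space (perc_law L (1 - \<delta>) J). infinite (cluster0 L \<omega> \<eta>)}"
    by linarith
  moreover have "isometry_invariant L J" by (simp add: isometry_invariant_def J_def)
  ultimately show ?thesis
    using asymp jf0 by (intro exI[of _ "1 - \<delta>"] exI[of _ J]) (auto simp: \<delta>_def J_def)
qed

end
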